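(* Let $\varphi: \mathcal U^+_q \to U^+_q \otimes \mathbb F \lbrack z_1, z_2,\ldots\rbrack$ be the algebra homomorphism that sends, for all $n \in \mathbb N$, $$\mathcal W_{-n} \mapsto \sum_{k=0}^n W_{k-n} \otimes z_k,\quad \mathcal W_{n+1} \mapsto \sum_{k=0}^n W_{n+1-k} \otimes z_k,\quad \mathcal G_{n} \mapsto \sum_{k=0}^n G_{n-k} \otimes z_k,\quad \mathcal {\tilde G}_{n} \mapsto \sum_{k=0}^n \tilde G_{n-k} \otimes z_k,$$ and let $\phi: U^+_q \otimes \mathbb F \lbrack z_1, z_2,\ldots \rbrack \to \mathcal U^+_q$ be the algebra homomorphism that sends $$W_0 \otimes 1 \mapsto \mathcal W_0,\qquad W_1 \otimes 1 \mapsto \mathcal W_1,\qquad 1 \otimes z_n \mapsto Z_n \quad (n \geq 1).$$ Then the maps $\varphi$, $\phi$ are inverses. Moreover they are bijections.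
   Context: Let $\mathbb F$ be a field and fix a nonzero $q\in\mathbb F$ that is not a root of unity. $\mathbb N=\{0,1,2,\ldots\}$. All algebras are associative, over $\mathbb F$, with multiplicative identity; tensor products are over $\mathbb F$. For elements $X,Y$ of an algebra, $[X,Y]=XY-YX$, and $[X,Y]_q=qXY-q^{-1}YX$ (so $[X,Y]_{q^{-1}}=q^{-1}XY-qYX$). The algebra $U^+_q$ is defined by generators $A,B$ and the relations $[A,[A,[A,B]_q]_{q^{-1}}]=0$, $[B,[B,[B,A]_q]_{q^{-1}}]=0$. Its alternating elements $W_{-k}, W_{k+1}, G_{k+1}, \tilde G_{k+1}$ ($k\in\mathbb N$) are the elements determined recursively, in the order $W_0,W_1,G_1,\tilde G_1,W_{-1},W_2,G_2,\tilde G_2,W_{-2},W_3,\ldots$, by $W_0=A$, $W_1=B$, and for $n\ge 1$ $$G_n = \frac{q\sum_{k=0}^{n-1} W_{-k} W_{n-k} q^{n-1-2k}-\sum_{k=1}^{n-1} G_k \tilde G_{n-k} q^{n-2k}}{q^n+q^{-n}}+\frac{W_n W_0-W_0 W_n}{(1+q^{-2n})(1-q^{-2})},$$ $$\tilde G_n = G_n + \frac{W_0 W_n-W_n W_0}{1-q^{-2}},\quad W_{-n} = \frac{q W_0 G_n - q^{-1} G_n W_0}{q-q^{-1}},\quad W_{n+1} = \frac{q G_n W_1 - q^{-1} W_1 G_n}{q-q^{-1}}.$$ Also $G_0=\tilde G_0=1$. The algebra $\mathcal U^+_q$ is defined by generators (called alternating generators) $\mathcal W_{-k}, \mathcal W_{k+1},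 \mathcal G_{k+1}, \mathcal{\tilde G}_{k+1}$ ($k\in\mathbb N$) and the following relations for all $k,\ell\in\mathbb N$: $[\mathcal W_0,\mathcal W_{k+1}]=[\mathcal W_{-k},\mathcal W_1]=(1-q^{-2})(\mathcal{\tilde G}_{k+1}-\mathcal G_{k+1})$; $[\mathcal W_0,\mathcal G_{k+1}]_q=[\mathcal{\tilde G}_{k+1},\mathcal W_0]_q=(q-q^{-1})\mathcal W_{-k-1}$; $[\mathcal G_{k+1},\mathcal W_1]_q=[\mathcal W_1,\mathcal{\tilde G}_{k+1}]_q=(q-q^{-1})\mathcal W_{k+2}$; $[\mathcal W_{-k},\mathcal W_{-\ell}]=0$; $[\mathcal W_{k+1},\mathcal W_{\ell+1}]=0$; $[\mathcal W_{-k},\mathcal W_{\ell+1}]+[\mathcal W_{k+1},\mathcal W_{-\ell}]=0$; $[\mathcal W_{-k},\mathcal G_{\ell+1}]+[\mathcal G_{k+1},\mathcal W_{-\ell}]=0$; $[\mathcal W_{-k},\mathcal{\tilde G}_{\ell+1}]+[\mathcal{\tilde G}_{k+1},\mathcal W_{-\ell}]=0$; $[\mathcal W_{k+1},\mathcal G_{\ell+1}]+[\mathcal G_{k+1},\mathcal W_{\ell+1}]=0$; $[\mathcal W_{k+1},\mathcal{\tilde G}_{\ell+1}]+[\mathcal{\tilde G}_{k+1},\mathcal W_{\ell+1}]=0$; $[\mathcal G_{k+1},\mathcal G_{\ell+1}]=0$; $[\mathcal{\tilde G}_{k+1},\mathcal{\tilde G}_{\ell+1}]=0$; $[\mathcal{\tilde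 G}_{k+1},\mathcal G_{\ell+1}]+[\mathcal G_{k+1},\mathcal{\tilde G}_{\ell+1}]=0$. Also $\mathcal G_0=\mathcal{\tilde G}_0=1$. $\mathbb F[z_1,z_2,\ldots]$ is the polynomial algebra in mutually commuting indeterminates $\{z_n\}_{n=1}^\infty$, and $z_0=1$. In $\mathcal U^+_q$ define, for $n\ge1$, $Z^\vee_n=\sum_{k=0}^n\mathcal G_k\mathcal{\tilde G}_{n-k}q^{n-2k}-q\sum_{k=0}^{n-1}\mathcal W_{-k}\mathcal W_{n-k}q^{n-1-2k}$, and $Z^\vee_0=1$. Define recursively $Z_0=1$ and, for $n\ge 1$, $Z_n=\bigl(Z^\vee_n-\sum_{k=1}^{n-1}Z_kZ_{n-k}q^{n-2k}\bigr)/(q^n+q^{-n})$. The homomorphisms $\varphi$ and $\phi$ with the stated values exist (and are uniquely determined by these values). *)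

theory Defs
  imports
    "HOL-Algebra.QuotRing"
    "HOL-Algebra.Module"
    "HOL-Library.Poly_Mapping"
begin

section \<open>Algebras over a field\<close>

text \<open>
  The ground field is a type of class \<^class>\<open>field\<close>. An algebra over it is a
  \<^type>\<open>module_ext\<close> record, used for its ring operations together with its scalar
  multiplication (the locale \<^locale>\<open>algebra\<close> of the library is not used, since it demands
  a commutative multiplication).
\<close>

definition alg_hom :: "('a, 'b) module \<Rightarrow> ('a, 'c) module \<Rightarrow> ('b \<Rightarrow> 'c) set" where
  "alg_hom A B = {h \<in> ring_hom A B. \<forall>c. \<forall>x\<in>carrier A. h (c \<odot>\<^bsub>A\<^esub> x) = c \<odot>\<^bsub>B\<^esub> h x}"

definition comm :: "('a, 'b) module \<Rightarrow> 'b \<Rightarrow> 'b \<Rightarrow> 'b" where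
  "comm A x y = (x \<otimes>\<^bsub>A\<^esub> y) \<ominus>\<^bsub>A\<^esub> (y \<otimes>\<^bsub>A\<^esub> x)"

definition qcomm :: "('a::field, 'b) module \<Rightarrow> 'a \<Rightarrow> 'b \<Rightarrow> 'b \<Rightarrow> 'b" where
  "qcomm A q x y = (q \<odot>\<^bsub>A\<^esub> (x \<otimes>\<^bsub>A\<^esub> y)) \<ominus>\<^bsub>A\<^esub> (inverse q \<odot>\<^bsub>A\<^esub> (y \<otimes>\<^bsub>A\<^esub> x))"

text \<open>
  Quotient of an algebra by a two-sided ideal \<open>I\<close>. If \<open>X\<close> is the coset of \<open>x\<close>, then
  \<open>I <+> c X\<close> is the coset of \<open>c x\<close>; adding \<open>I\<close> matters only for \<open>c = 0\<close>.
\<close>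

definition quot_alg :: "('a, 'b) module \<Rightarrow> 'b set \<Rightarrow> ('a, 'b set) module" where
  "quot_alg A I =
    \<lparr>carrier = carrier (A Quot I), mult = mult (A Quot I), one = one (A Quot I),
     zero = zero (A Quot I), add = add (A Quot I),
     smult = (\<lambda>c X. I <+>\<^bsub>A\<^esub> ((\<lambda>x. c \<odot>\<^bsub>A\<^esub> x) ` X))\<rparr>"

text \<open>The algebra with basis the monoid \<open>M\<close>, whose multiplication extends that of \<open>M\<close>.\<close>

definition monoid_alg :: "('m, 'x) monoid_scheme \<Rightarrow> ('a::field, 'm \<Rightarrow>\<^sub>0 'a) module" where
  "monoid_alg M =
    \<lparr>carrier = {p. Poly_Mapping.keys p \<subseteq> carrier M},
     mult = (\<lambda>p r. \<Sum>x\<in>Poly_Mapping.keys p. \<Sum>y\<in>Poly_Mapping.keys r.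
       Poly_Mapping.single (x \<otimes>\<^bsub>M\<^esub> y) (Poly_Mapping.lookup p x * Poly_Mapping.lookup r y)),
     one = Poly_Mapping.single \<one>\<^bsub>M\<^esub> 1,
     zero = 0, add = (+),
     smult = (\<lambda>c. Poly_Mapping.map (\<lambda>x. c * x))\<rparr>"


section \<open>Algebras defined by generators and relations\<close>

definition free_alg :: "('a::field, 'g list \<Rightarrow>\<^sub>0 'a) module" where
  "free_alg = monoid_alg \<lparr>carrier = UNIV, mult = (@), one = []\<rparr>"

definition free_gen :: "'g \<Rightarrow> ('g list \<Rightarrow>\<^sub>0 'a::field)" where
  "free_gen g = Poly_Mapping.single [g] 1"

text \<open>A pair \<open>(x, y)\<close> in \<open>R\<close> stands for the relation \<open>x = y\<close>.\<close>

definition rel_ideal ::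
  "(('g list \<Rightarrow>\<^sub>0 'a::field) \<times> ('g list \<Rightarrow>\<^sub>0 'a)) set \<Rightarrow> ('g list \<Rightarrow>\<^sub>0 'a) set" where
  "rel_ideal R = Idl\<^bsub>free_alg\<^esub> {x \<ominus>\<^bsub>free_alg\<^esub> y | x y. (x, y) \<in> R}"

definition presented_alg ::
  "(('g list \<Rightarrow>\<^sub>0 'a::field) \<times> ('g list \<Rightarrow>\<^sub>0 'a)) set \<Rightarrow> ('a, ('g list \<Rightarrow>\<^sub>0 'a) set) module" where
  "presented_alg R = quot_alg free_alg (rel_ideal R)"

definition presented_gen ::
  "(('g list \<Rightarrow>\<^sub>0 'a::field) \<times> ('g list \<Rightarrow>\<^sub>0 'a)) set \<Rightarrow> 'g \<Rightarrow> ('g list \<Rightarrow>\<^sub>0 'a) set" where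
  "presented_gen R g = rel_ideal R +>\<^bsub>free_alg\<^esub> free_gen g"


section \<open>Tensor products and polynomials\<close>

text \<open>
  The tensor product is the free vector space on \<open>A \<times> B\<close>, with \<open>(a, b) (a', b') = (a a', b b')\<close>,
  modulo the bilinearity relations. The set of these relations is stable up to scalars under
  multiplication by basis elements \<open>(a, b)\<close> from either side, so the ideal it generates is just
  its linear span.
\<close>

inductive_set tensor_rels ::
    "('a::field, 'b) module \<Rightarrow> ('a, 'c) module \<Rightarrow> ('b \<times> 'c \<Rightarrow>\<^sub>0 'a) set"
  for A :: "('a, 'b) module" and B :: "('a, 'c) module" where
  add_left: "\<lbrakk>a \<in> carrier A; a' \<in> carrier A; b \<in> carrier B\<rbrakk> \<Longrightarrow>
     Poly_Mapping.single (a \<oplus>\<^bsub>A\<^esub> a', b) 1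
       - (Poly_Mapping.single (a, b) 1 + Poly_Mapping.single (a', b) 1) \<in> tensor_rels A B"
| add_right: "\<lbrakk>a \<in> carrier A; b \<in> carrier B; b' \<in> carrier B\<rbrakk> \<Longrightarrow>
     Poly_Mapping.single (a, b \<oplus>\<^bsub>B\<^esub> b') 1
       - (Poly_Mapping.single (a, b) 1 + Poly_Mapping.single (a, b') 1) \<in> tensor_rels A B"
| smult_left: "\<lbrakk>a \<in> carrier A; b \<in> carrier B\<rbrakk> \<Longrightarrow>
     Poly_Mapping.single (c \<odot>\<^bsub>A\<^esub> a, b) 1 - Poly_Mapping.single (a, b) c \<in> tensor_rels A B"
| smult_right: "\<lbrakk>a \<in> carrier A; b \<in> carrier B\<rbrakk> \<Longrightarrow>
     Poly_Mapping.single (a, c \<odot>\<^bsub>B\<^esub> b) 1 - Poly_Mapping.single (a, b) c \<in> tensor_rels A B"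

definition tensor_ideal ::
  "('a::field, 'b) module \<Rightarrow> ('a, 'c) module \<Rightarrow> ('b \<times> 'c \<Rightarrow>\<^sub>0 'a) set" where
  "tensor_ideal A B = Idl\<^bsub>monoid_alg (A \<times>\<times> B)\<^esub> (tensor_rels A B)"

definition tensor_alg ::
  "('a::field, 'b) module \<Rightarrow> ('a, 'c) module \<Rightarrow> ('a, ('b \<times> 'c \<Rightarrow>\<^sub>0 'a) set) module" where
  "tensor_alg A B = quot_alg (monoid_alg (A \<times>\<times> B)) (tensor_ideal A B)"

definition tensor ::
  "('a::field, 'b) module \<Rightarrow> ('a, 'c) module \<Rightarrow> 'b \<Rightarrow> 'c \<Rightarrow> ('b \<times> 'c \<Rightarrow>\<^sub>0 'a) set" where
  "tensor A B a b = tensor_ideal A B +>\<^bsub>monoid_alg (A \<times>\<times> B)\<^esub> Poly_Mapping.single (a, b) 1"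

text \<open>
  Polynomials in \<open>z\<^sub>1, z\<^sub>2, \<dots>\<close>; monomials are finitely supported exponent functions on
  \<^typ>\<open>nat\<close>, with index \<open>n - 1\<close> belonging to \<open>z\<^sub>n\<close>.
\<close>

definition poly_alg :: "('a::field, (nat \<Rightarrow>\<^sub>0 nat) \<Rightarrow>\<^sub>0 'a) module" where
  "poly_alg =
    \<lparr>carrier = UNIV, mult = (*), one = 1, zero = 0, add = (+),
     smult = (\<lambda>c. Poly_Mapping.map (\<lambda>x. c * x))\<rparr>"

definition zvar :: "nat \<Rightarrow> (nat \<Rightarrow>\<^sub>0 nat) \<Rightarrow>\<^sub>0 'a::field" where
  "zvar n = (if n = 0 then 1 else Poly_Mapping.single (Poly_Mapping.single (n - 1) 1) 1)"


section \<open>The algebra \<open>U\<^sup>+\<^sub>q\<close>\<close>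

datatype U_gen = genA | genB

inductive_set U_rels ::
    "'a::field \<Rightarrow> ((U_gen list \<Rightarrow>\<^sub>0 'a) \<times> (U_gen list \<Rightarrow>\<^sub>0 'a)) set"
  for q :: 'a where
  "(comm free_alg (free_gen genA)
      (qcomm free_alg (inverse q) (free_gen genA)
        (qcomm free_alg q (free_gen genA) (free_gen genB))),
    \<zero>\<^bsub>free_alg\<^esub>) \<in> U_rels q"
| "(comm free_alg (free_gen genB)
      (qcomm free_alg (inverse q) (free_gen genB)
        (qcomm free_alg q (free_gen genB) (free_gen genA))),
    \<zero>\<^bsub>free_alg\<^esub>) \<in> U_rels q"

definition U_alg :: "'a::field \<Rightarrow> ('a, (U_gen list \<Rightarrow>\<^sub>0 'a) set) module" where
  "U_alg q = presented_alg (U_rels q)"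

text \<open>
  The next two lemmas let the function package see that a finite sum in a ring record depends
  only on the summands with index in the given set.
\<close>

lemma foldSetD_cong_on:
  assumes "(A, x) \<in> foldSetD D f e" "\<And>a. a \<in> A \<Longrightarrow> f a = g a"
  shows "(A, x) \<in> foldSetD D g e"
  using assms
proof (induction rule: foldSetD.induct)
  case emptyI
  then show ?case by (auto intro: foldSetD.emptyI)
next
  case (insertI x A y)
  have "(insert x A, g x y) \<in> foldSetD D g e"
  proof (rule foldSetD.insertI)
    show "g x y \<in> D" using insertI by (metis insertI1)
  qed (use insertI in auto)
  moreover have "f x = g x" using insertI.prems by blast
  ultimately show ?case by metis
qed

lemma finsum_fundef_cong [fundef_cong]:
  assumes "R = S" "A = B" "\<And>i. i \<in> B \<Longrightarrow> f i = g i"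
  shows "finsum R f A = finsum S g B"
proof -
  let ?F = "\<lambda>h. foldSetD (carrier (add_monoid S)) (mult (add_monoid S) \<circ> h) \<one>\<^bsub>add_monoid S\<^esub>"
  have "(B, x) \<in> ?F f \<longleftrightarrow> (B, x) \<in> ?F g" for x
    using assms(3) by (auto elim!: foldSetD_cong_on)
  then show ?thesis
    using assms(1,2) by (simp add: finsum_def finprod_def foldD_def)
qed

text \<open>
  The alternating elements; \<open>W i\<close> is defined for all integers \<open>i\<close>, so the elements
  \<open>W\<^bsub>-k\<^esub>\<close> and \<open>W\<^bsub>k+1\<^esub>\<close> (for natural numbers \<open>k\<close>) are all of them. The defining
  formulas in their usual form are \<open>alt_W_neg\<close>, \<open>alt_W_pos\<close>, \<open>alt_G_pos\<close> and \<open>alt_Gt_pos\<close> below.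
\<close>

function (sequential)
  alt_W :: "'a::field \<Rightarrow> int \<Rightarrow> (U_gen list \<Rightarrow>\<^sub>0 'a) set" and
  alt_G :: "'a \<Rightarrow> nat \<Rightarrow> (U_gen list \<Rightarrow>\<^sub>0 'a) set" and
  alt_Gt :: "'a \<Rightarrow> nat \<Rightarrow> (U_gen list \<Rightarrow>\<^sub>0 'a) set" where
  "alt_W q i =
    (if i = 0 then presented_gen (U_rels q) genA
     else if i = 1 then presented_gen (U_rels q) genB
     else if i < 0 then
       (1 / (q - inverse q)) \<odot>\<^bsub>U_alg q\<^esub>
         qcomm (U_alg q) q (alt_W q 0) (alt_G q (nat (- i)))
     else
       (1 / (q - inverse q)) \<odot>\<^bsub>U_alg q\<^esub>
         qcomm (U_alg q) q (alt_G q (nat (i - 1))) (alt_W q 1))"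
| "alt_G q n =
    (if n = 0 then \<one>\<^bsub>U_alg q\<^esub>
     else
       ((1 / (q powi int n + q powi (- int n))) \<odot>\<^bsub>U_alg q\<^esub>
         ((q \<odot>\<^bsub>U_alg q\<^esub>
            (\<Oplus>\<^bsub>U_alg q\<^esub>k\<in>{0..<n}. (q powi (int n - 1 - 2 * int k)) \<odot>\<^bsub>U_alg q\<^esub>
               (alt_W q (- int k) \<otimes>\<^bsub>U_alg q\<^esub> alt_W q (int n - int k))))
          \<ominus>\<^bsub>U_alg q\<^esub>
          (\<Oplus>\<^bsub>U_alg q\<^esub>k\<in>{1..<n}. (q powi (int n - 2 * int k)) \<odot>\<^bsub>U_alg q\<^esub>
               (alt_G q k \<otimes>\<^bsub>U_alg q\<^esub> alt_Gt q (n - k)))))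
       \<oplus>\<^bsub>U_alg q\<^esub>
       ((1 / ((1 + q powi (- 2 * int n)) * (1 - q powi (- 2)))) \<odot>\<^bsub>U_alg q\<^esub>
         comm (U_alg q) (alt_W q (int n)) (alt_W q 0)))"
| "alt_Gt q n =
    (if n = 0 then \<one>\<^bsub>U_alg q\<^esub>
     else
       alt_G q n \<oplus>\<^bsub>U_alg q\<^esub>
       ((1 / (1 - q powi (- 2))) \<odot>\<^bsub>U_alg q\<^esub>
         comm (U_alg q) (alt_W q 0) (alt_W q (int n))))"
  by pat_completeness auto
termination
  by (relation "measure (\<lambda>x. case x of
        Inl (q, i) \<Rightarrow> (if i \<le> 0 then nat (4 * (- i)) + 2 else nat (4 * (i - 1)) + 2)
      | Inr (Inl (q, n)) \<Rightarrow> 4 * n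
      | Inr (Inr (q, n)) \<Rightarrow> 4 * n + 1)")
    (auto simp: nat_less_iff)

declare alt_W.simps [simp del] alt_G.simps [simp del] alt_Gt.simps [simp del]

lemma alt_W_0: "alt_W q 0 = presented_gen (U_rels q) genA"
  and alt_W_1: "alt_W q 1 = presented_gen (U_rels q) genB"
  and alt_G_0: "alt_G q 0 = \<one>\<^bsub>U_alg q\<^esub>"
  and alt_Gt_0: "alt_Gt q 0 = \<one>\<^bsub>U_alg q\<^esub>"
  by (simp_all add: alt_W.simps alt_G.simps alt_Gt.simps)

lemma alt_W_neg: "n \<ge> 1 \<Longrightarrow> alt_W q (- int n) =
    (1 / (q - inverse q)) \<odot>\<^bsub>U_alg q\<^esub>
      ((q \<odot>\<^bsub>U_alg q\<^esub> (alt_W q 0 \<otimes>\<^bsub>U_alg q\<^esub> alt_G q n)) \<ominus>\<^bsub>U_alg q\<^esub>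
       (inverse q \<odot>\<^bsub>U_alg q\<^esub> (alt_G q n \<otimes>\<^bsub>U_alg q\<^esub> alt_W q 0)))"
  by (subst alt_W.simps) (simp add: qcomm_def)

lemma alt_W_pos: "n \<ge> 1 \<Longrightarrow> alt_W q (int n + 1) =
    (1 / (q - inverse q)) \<odot>\<^bsub>U_alg q\<^esub>
      ((q \<odot>\<^bsub>U_alg q\<^esub> (alt_G q n \<otimes>\<^bsub>U_alg q\<^esub> alt_W q 1)) \<ominus>\<^bsub>U_alg q\<^esub>
       (inverse q \<odot>\<^bsub>U_alg q\<^esub> (alt_W q 1 \<otimes>\<^bsub>U_alg q\<^esub> alt_G q n)))"
  by (subst alt_W.simps) (simp add: qcomm_def)

lemma alt_G_pos: "n \<ge> 1 \<Longrightarrow> alt_G q n =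
    ((1 / (q powi int n + q powi (- int n))) \<odot>\<^bsub>U_alg q\<^esub>
      ((q \<odot>\<^bsub>U_alg q\<^esub>
         (\<Oplus>\<^bsub>U_alg q\<^esub>k\<in>{0..n-1}. (q powi (int n - 1 - 2 * int k)) \<odot>\<^bsub>U_alg q\<^esub>
            (alt_W q (- int k) \<otimes>\<^bsub>U_alg q\<^esub> alt_W q (int n - int k))))
       \<ominus>\<^bsub>U_alg q\<^esub>
       (\<Oplus>\<^bsub>U_alg q\<^esub>k\<in>{1..n-1}. (q powi (int n - 2 * int k)) \<odot>\<^bsub>U_alg q\<^esub>
            (alt_G q k \<otimes>\<^bsub>U_alg q\<^esub> alt_Gt q (n - k)))))
    \<oplus>\<^bsub>U_alg q\<^esub>
    ((1 / ((1 + q powi (- 2 * int n)) * (1 - q powi (- 2)))) \<odot>\<^bsub>U_alg q\<^esub>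
      ((alt_W q (int n) \<otimes>\<^bsub>U_alg q\<^esub> alt_W q 0) \<ominus>\<^bsub>U_alg q\<^esub>
       (alt_W q 0 \<otimes>\<^bsub>U_alg q\<^esub> alt_W q (int n))))"
proof -
  assume n: "n \<ge> 1"
  then have "{0..n-1} = {0..<n}" "{1..n-1} = {1..<n}" by auto
  with n show ?thesis by (subst alt_G.simps) (simp add: comm_def)
qed

lemma alt_Gt_pos: "n \<ge> 1 \<Longrightarrow> alt_Gt q n =
    alt_G q n \<oplus>\<^bsub>U_alg q\<^esub>
    ((1 / (1 - q powi (- 2))) \<odot>\<^bsub>U_alg q\<^esub>
      ((alt_W q 0 \<otimes>\<^bsub>U_alg q\<^esub> alt_W q (int n)) \<ominus>\<^bsub>U_alg q\<^esub>
       (alt_W q (int n) \<otimes>\<^bsub>U_alg q\<^esub> alt_W q 0)))"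
  by (subst alt_Gt.simps) (simp add: comm_def)


section \<open>The algebra \<open>\<U>\<^sup>+\<^sub>q\<close>\<close>

text \<open>
  \<open>genW i\<close> is the alternating generator with integer index \<open>i\<close> (both families
  \<open>\<W>\<^bsub>-k\<^esub>\<close> and \<open>\<W>\<^bsub>k+1\<^esub>\<close>), while \<open>genG k\<close> and \<open>genGt k\<close> are the generators with
  index \<open>k + 1\<close>.
\<close>

datatype alt_gen = genW int | genG nat | genGt nat

abbreviation fW :: "int \<Rightarrow> (alt_gen list \<Rightarrow>\<^sub>0 'a::field)" where
  "fW i \<equiv> free_gen (genW i)"

abbreviation fG :: "nat \<Rightarrow> (alt_gen list \<Rightarrow>\<^sub>0 'a::field)" where
  "fG n \<equiv> (if n = 0 then \<one>\<^bsub>free_alg\<^esub> else free_gen (genG (n - 1)))"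

abbreviation fGt :: "nat \<Rightarrow> (alt_gen list \<Rightarrow>\<^sub>0 'a::field)" where
  "fGt n \<equiv> (if n = 0 then \<one>\<^bsub>free_alg\<^esub> else free_gen (genGt (n - 1)))"

inductive_set calU_rels ::
    "'a::field \<Rightarrow> ((alt_gen list \<Rightarrow>\<^sub>0 'a) \<times> (alt_gen list \<Rightarrow>\<^sub>0 'a)) set"
  for q :: 'a where
  "(comm free_alg (fW 0) (fW (int k + 1)),
    (1 - q powi (- 2)) \<odot>\<^bsub>free_alg\<^esub> (fGt (k + 1) \<ominus>\<^bsub>free_alg\<^esub> fG (k + 1))) \<in> calU_rels q"
| "(comm free_alg (fW (- int k)) (fW 1),
    (1 - q powi (- 2)) \<odot>\<^bsub>free_alg\<^esub> (fGt (k + 1) \<ominus>\<^bsub>free_alg\<^esub> fG (k + 1))) \<in> calU_rels q"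
| "(qcomm free_alg q (fW 0) (fG (k + 1)),
    (q - inverse q) \<odot>\<^bsub>free_alg\<^esub> fW (- int k - 1)) \<in> calU_rels q"
| "(qcomm free_alg q (fGt (k + 1)) (fW 0),
    (q - inverse q) \<odot>\<^bsub>free_alg\<^esub> fW (- int k - 1)) \<in> calU_rels q"
| "(qcomm free_alg q (fG (k + 1)) (fW 1),
    (q - inverse q) \<odot>\<^bsub>free_alg\<^esub> fW (int k + 2)) \<in> calU_rels q"
| "(qcomm free_alg q (fW 1) (fGt (k + 1)),
    (q - inverse q) \<odot>\<^bsub>free_alg\<^esub> fW (int k + 2)) \<in> calU_rels q"
| "(comm free_alg (fW (- int k)) (fW (- int l)), \<zero>\<^bsub>free_alg\<^esub>) \<in> calU_rels q"
| "(comm free_alg (fW (int k + 1)) (fW (int l + 1)), \<zero>\<^bsub>free_alg\<^esub>) \<in> calU_rels q"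
| "(comm free_alg (fW (- int k)) (fW (int l + 1)) \<oplus>\<^bsub>free_alg\<^esub>
    comm free_alg (fW (int k + 1)) (fW (- int l)), \<zero>\<^bsub>free_alg\<^esub>) \<in> calU_rels q"
| "(comm free_alg (fW (- int k)) (fG (l + 1)) \<oplus>\<^bsub>free_alg\<^esub>
    comm free_alg (fG (k + 1)) (fW (- int l)), \<zero>\<^bsub>free_alg\<^esub>) \<in> calU_rels q"
| "(comm free_alg (fW (- int k)) (fGt (l + 1)) \<oplus>\<^bsub>free_alg\<^esub>
    comm free_alg (fGt (k + 1)) (fW (- int l)), \<zero>\<^bsub>free_alg\<^esub>) \<in> calU_rels q"
| "(comm free_alg (fW (int k + 1)) (fG (l + 1)) \<oplus>\<^bsub>free_alg\<^esub>
    comm free_alg (fG (k + 1)) (fW (int l + 1)), \<zero>\<^bsub>free_alg\<^esub>) \<in> calU_rels q"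
| "(comm free_alg (fW (int k + 1)) (fGt (l + 1)) \<oplus>\<^bsub>free_alg\<^esub>
    comm free_alg (fGt (k + 1)) (fW (int l + 1)), \<zero>\<^bsub>free_alg\<^esub>) \<in> calU_rels q"
| "(comm free_alg (fG (k + 1)) (fG (l + 1)), \<zero>\<^bsub>free_alg\<^esub>) \<in> calU_rels q"
| "(comm free_alg (fGt (k + 1)) (fGt (l + 1)), \<zero>\<^bsub>free_alg\<^esub>) \<in> calU_rels q"
| "(comm free_alg (fGt (k + 1)) (fG (l + 1)) \<oplus>\<^bsub>free_alg\<^esub>
    comm free_alg (fG (k + 1)) (fGt (l + 1)), \<zero>\<^bsub>free_alg\<^esub>) \<in> calU_rels q"

definition calU_alg :: "'a::field \<Rightarrow> ('a, (alt_gen list \<Rightarrow>\<^sub>0 'a) set) module" where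
  "calU_alg q = presented_alg (calU_rels q)"

definition calW :: "'a::field \<Rightarrow> int \<Rightarrow> (alt_gen list \<Rightarrow>\<^sub>0 'a) set" where
  "calW q i = presented_gen (calU_rels q) (genW i)"

definition calG :: "'a::field \<Rightarrow> nat \<Rightarrow> (alt_gen list \<Rightarrow>\<^sub>0 'a) set" where
  "calG q n = (if n = 0 then \<one>\<^bsub>calU_alg q\<^esub> else presented_gen (calU_rels q) (genG (n - 1)))"

definition calGt :: "'a::field \<Rightarrow> nat \<Rightarrow> (alt_gen list \<Rightarrow>\<^sub>0 'a) set" where
  "calGt q n = (if n = 0 then \<one>\<^bsub>calU_alg q\<^esub> else presented_gen (calU_rels q) (genGt (n - 1)))"

definition Z_vee :: "'a::field \<Rightarrow> nat \<Rightarrow> (alt_gen list \<Rightarrow>\<^sub>0 'a) set" where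
  "Z_vee q n =
    (if n = 0 then \<one>\<^bsub>calU_alg q\<^esub>
     else
       (\<Oplus>\<^bsub>calU_alg q\<^esub>k\<in>{0..n}. (q powi (int n - 2 * int k)) \<odot>\<^bsub>calU_alg q\<^esub>
          (calG q k \<otimes>\<^bsub>calU_alg q\<^esub> calGt q (n - k)))
       \<ominus>\<^bsub>calU_alg q\<^esub>
       (q \<odot>\<^bsub>calU_alg q\<^esub>
         (\<Oplus>\<^bsub>calU_alg q\<^esub>k\<in>{0..n-1}. (q powi (int n - 1 - 2 * int k)) \<odot>\<^bsub>calU_alg q\<^esub>
            (calW q (- int k) \<otimes>\<^bsub>calU_alg q\<^esub> calW q (int n - int k)))))"

function Z_elt :: "'a::field \<Rightarrow> nat \<Rightarrow> (alt_gen list \<Rightarrow>\<^sub>0 'a) set" where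
  "Z_elt q n =
    (if n = 0 then \<one>\<^bsub>calU_alg q\<^esub>
     else
       (1 / (q powi int n + q powi (- int n))) \<odot>\<^bsub>calU_alg q\<^esub>
         (Z_vee q n \<ominus>\<^bsub>calU_alg q\<^esub>
          (\<Oplus>\<^bsub>calU_alg q\<^esub>k\<in>{1..<n}. (q powi (int n - 2 * int k)) \<odot>\<^bsub>calU_alg q\<^esub>
             (Z_elt q k \<otimes>\<^bsub>calU_alg q\<^esub> Z_elt q (n - k)))))"
  by pat_completeness auto
termination by (relation "measure snd") auto

declare Z_elt.simps [simp del]

definition U_poly_alg ::
  "'a::field \<Rightarrow> ('a, ((U_gen list \<Rightarrow>\<^sub>0 'a) set \<times> ((nat \<Rightarrow>\<^sub>0 nat) \<Rightarrow>\<^sub>0 'a) \<Rightarrow>\<^sub>0 'a) set) module" where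
  "U_poly_alg q = tensor_alg (U_alg q) poly_alg"

definition U_tensor ::
  "'a::field \<Rightarrow> (U_gen list \<Rightarrow>\<^sub>0 'a) set \<Rightarrow> ((nat \<Rightarrow>\<^sub>0 nat) \<Rightarrow>\<^sub>0 'a)
    \<Rightarrow> ((U_gen list \<Rightarrow>\<^sub>0 'a) set \<times> ((nat \<Rightarrow>\<^sub>0 nat) \<Rightarrow>\<^sub>0 'a) \<Rightarrow>\<^sub>0 'a) set" where
  "U_tensor q u p = tensor (U_alg q) poly_alg u p"

end

theory Submission
  imports Defs "HOL-Algebra.UnivPoly"
begin

text \<open>
  Write \<open>W\<^sup>-(t)\<close>, \<open>W\<^sup>+(t)\<close>, \<open>G(t)\<close>, \<open>G'(t)\<close> for the generating series
  of the elements \<open>W\<^bsub>-n\<^esub>\<close>, \<open>W\<^bsub>n+1\<^esub>\<close>, \<open>G\<^sub>n\<close> and \<open>G'\<^sub>n\<close>, in either algebra; here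
  \<open>G'\<^sub>n\<close> stands for the element usually written as \<open>G\<^sub>n\<close> with a tilde. Call such
  a quadruple, in any associative algebra, an \<^emph>\<open>alternating system\<close> with defect \<open>D(t)\<close> if it
  satisfies the three relations that express \<open>G'(t) - G(t)\<close>, \<open>W\<^sup>-(t)\<close> and \<open>W\<^sup>+(t)\<close> through
  commutators with \<open>W\<^sub>0\<close> and \<open>W\<^sub>1\<close>, together with
  \<open>G(t/q) G'(qt) - q t W\<^sup>-(t/q) W\<^sup>+(qt) = D(t)\<close>. Four facts about such systems carry the proof.

  \<^item> A system is determined by \<open>W\<^sub>0\<close>, \<open>W\<^sub>1\<close> and \<open>D\<close>
    (\<open>alternating_system.unique\<close>): in degree \<open>n\<close> one knows \<open>G'\<^sub>n - G\<^sub>n\<close> and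
    \<open>q\<^sup>n G'\<^sub>n + q\<^sup>-\<^sup>n G\<^sub>n\<close> from lower degrees, and \<open>q\<^sup>n + q\<^sup>-\<^sup>n \<noteq> 0\<close>.
  \<^item> Multiplying all series of a system with defect \<open>1\<close> by a series \<open>Z(t)\<close> with constant term
    \<open>1\<close> that commutes with them gives a system with defect \<open>Z(t/q) Z(qt)\<close>
    (\<open>alternating_system.conv_system\<close>), and this defect determines \<open>Z\<close> (\<open>twconv_self_inj\<close>).
  \<^item> The alternating elements of \<open>U\<^sup>+\<^sub>q\<close> form a system with defect \<open>1\<close>
    (\<open>alternating_system_U\<close>), and the alternating generators of \<open>\<U>\<^sup>+\<^sub>q\<close> form one
    whose defect has the coefficients \<open>Z\<^sup>\<or>\<^sub>n\<close>, that is, the defect \<open>Z(t/q) Z(qt)\<close> for the series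
    of the elements \<open>Z\<^sub>n\<close> (\<open>alternating_system_calU\<close>).
  \<^item> Algebra homomorphisms map systems to systems (\<open>hom_alternating_system\<close>).

  The values prescribed for \<open>varphi\<close> say that it sends each series of generators of
  \<open>\<U>\<^sup>+\<^sub>q\<close> to the corresponding series of \<open>U\<^sup>+\<^sub>q\<close> times \<open>z(t)\<close>. The image is a system with
  defect \<open>z(t/q) z(qt)\<close> by the second fact, and with defect \<open>Y(t/q) Y(qt)\<close> by the fourth, where
  \<open>Y(t)\<close> has the coefficients \<open>varphi Z\<^sub>n\<close>; hence \<open>varphi Z\<^sub>n = z\<^sub>n\<close>. So \<open>varphi \<circ> phi\<close> fixes the
  generators \<open>W\<^sub>0\<close>, \<open>W\<^sub>1\<close>, \<open>z\<^sub>n\<close> of the tensor product. Conversely, \<open>phi \<circ> varphi\<close> carries the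
  generators of \<open>\<U>\<^sup>+\<^sub>q\<close> to a system with the same defect, the same \<open>\<W>\<^sub>0\<close> and the same \<open>\<W>\<^sub>1\<close>,
  so by uniqueness it fixes every generator.
\<close>

section \<open>Associative algebras and their homomorphisms\<close>

locale assoc_alg = ring A for A :: "('a::field, 'b) module" (structure) +
  assumes smult_closed [simp, intro]: "x \<in> carrier A \<Longrightarrow> c \<odot> x \<in> carrier A"
    and smult_l_distr: "x \<in> carrier A \<Longrightarrow> (c + d) \<odot> x = c \<odot> x \<oplus> d \<odot> x"
    and smult_r_distr: "\<lbrakk>x \<in> carrier A; y \<in> carrier A\<rbrakk> \<Longrightarrow> c \<odot> (x \<oplus> y) = c \<odot> x \<oplus> c \<odot> y"
    and smult_smult: "x \<in> carrier A \<Longrightarrow> c \<odot> (d \<odot> x) = (c * d) \<odot> x"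
    and smult_one [simp]: "x \<in> carrier A \<Longrightarrow> 1 \<odot> x = x"
    and smult_assoc_left: "\<lbrakk>x \<in> carrier A; y \<in> carrier A\<rbrakk> \<Longrightarrow> (c \<odot> x) \<otimes> y = c \<odot> (x \<otimes> y)"
    and smult_assoc_right: "\<lbrakk>x \<in> carrier A; y \<in> carrier A\<rbrakk> \<Longrightarrow> x \<otimes> (c \<odot> y) = c \<odot> (x \<otimes> y)"
begin

lemma smult_zero_right [simp]: "c \<odot> \<zero> = \<zero>"
  using smult_r_distr[of \<zero> \<zero> c] smult_closed[of \<zero> c] by (metis add.r_cancel_one' l_zero zero_closed)

lemma smult_minus: "x \<in> carrier A \<Longrightarrow> c \<odot> (\<ominus> x) = \<ominus> (c \<odot> x)"
  using smult_r_distr[of "\<ominus> x" x c]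
  by (metis a_inv_closed local.minus_equality l_neg smult_closed smult_zero_right)

lemma smult_left_cancel:
  assumes "c \<noteq> 0" "x \<in> carrier A" "y \<in> carrier A" "c \<odot> x = c \<odot> y"
  shows "x = y"
proof -
  have "inverse c \<odot> (c \<odot> z) = z" if "z \<in> carrier A" for z
    using assms(1) that by (simp add: smult_smult)
  then show ?thesis using assms(2-4) by metis
qed

lemma diff_add_cancel: "\<lbrakk>x \<in> carrier A; y \<in> carrier A\<rbrakk> \<Longrightarrow> (x \<ominus> y) \<oplus> y = x"
  by (simp add: minus_eq a_assoc l_neg)

lemma add_diff_cancel: "\<lbrakk>x \<in> carrier A; y \<in> carrier A\<rbrakk> \<Longrightarrow> (x \<oplus> y) \<ominus> y = x"
  by (simp add: minus_eq a_assoc r_neg)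

lemma add_diff_add_cancel:
  assumes "x \<in> carrier A" "y \<in> carrier A" "z \<in> carrier A"
  shows "(x \<oplus> z) \<ominus> (y \<oplus> z) = x \<ominus> y"
proof -
  have "x \<oplus> z = (x \<ominus> y) \<oplus> (y \<oplus> z)"
    using assms diff_add_cancel[of x y] a_assoc[of "x \<ominus> y" y z] by simp
  then show ?thesis using assms by (simp add: add_diff_cancel)
qed

lemma smult_diff_left: "x \<in> carrier A \<Longrightarrow> c \<odot> x \<ominus> d \<odot> x = (c - d) \<odot> x"
  using smult_l_distr[of x "c - d" d] by (simp add: add_diff_cancel)

lemma comm_swap: "\<lbrakk>x \<in> carrier A; y \<in> carrier A\<rbrakk> \<Longrightarrow> comm A y x = \<ominus> comm A x y"
  by (simp add: comm_def minus_eq minus_add a_comm)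

lemma smult_finsum:
  assumes "f \<in> S \<rightarrow> carrier A"
  shows "c \<odot> finsum A f S = (\<Oplus>i\<in>S. c \<odot> f i)"
  using assms
proof (induction S rule: infinite_finite_induct)
  case (insert x F)
  then show ?case by (simp add: smult_r_distr Pi_def finsum_closed)
qed auto

lemma comm_closed [simp]: "\<lbrakk>x \<in> carrier A; y \<in> carrier A\<rbrakk> \<Longrightarrow> comm A x y \<in> carrier A"
  by (simp add: comm_def)

lemma qcomm_closed [simp]: "\<lbrakk>x \<in> carrier A; y \<in> carrier A\<rbrakk> \<Longrightarrow> qcomm A q x y \<in> carrier A"
  by (simp add: qcomm_def)

end

locale assoc_alg_hom = A?: assoc_alg A + B?: assoc_alg B
  for A :: "('a::field, 'b) module" (structure) and B :: "('a, 'c) module" (structure) +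
  fixes h
  assumes alg_hom: "h \<in> alg_hom A B"

sublocale assoc_alg_hom \<subseteq> ring_hom_ring A B h
  using alg_hom by unfold_locales (simp add: alg_hom_def)

context assoc_alg_hom
begin

lemma hom_smult [simp]: "x \<in> carrier A \<Longrightarrow> h (c \<odot>\<^bsub>A\<^esub> x) = c \<odot>\<^bsub>B\<^esub> h x"
  using alg_hom by (simp add: alg_hom_def)

lemma hom_diff [simp]:
  "\<lbrakk>x \<in> carrier A; y \<in> carrier A\<rbrakk> \<Longrightarrow> h (x \<ominus>\<^bsub>A\<^esub> y) = h x \<ominus>\<^bsub>B\<^esub> h y"
  by (simp add: A.minus_eq B.minus_eq)

lemma hom_comm [simp]: "\<lbrakk>x \<in> carrier A; y \<in> carrier A\<rbrakk> \<Longrightarrow> h (comm A x y) = comm B (h x) (h y)"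
  by (simp add: comm_def)

lemma hom_qcomm [simp]:
  "\<lbrakk>x \<in> carrier A; y \<in> carrier A\<rbrakk> \<Longrightarrow> h (qcomm A q x y) = qcomm B q (h x) (h y)"
  by (simp add: qcomm_def)

end

lemma alg_hom_compose:
  assumes "f \<in> alg_hom A B" "g \<in> alg_hom B C"
  shows "g \<circ> f \<in> alg_hom A C"
  using assms by (auto simp: alg_hom_def ring_hom_def Pi_def)

lemma alg_hom_id: "(\<lambda>x. x) \<in> alg_hom A A"
  by (auto simp: alg_hom_def ring_hom_def)


section \<open>Products of sequences\<close>

text \<open>
  Both sides sum \<open>f i j\<close> over the triangle \<open>i + j \<le> n\<close>, by diagonals and by rows; this is what
  associativity of the convolution product rests on.
\<close>

lemma (in abelian_monoid) finsum_triangle: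
  assumes "\<And>i j. f i j \<in> carrier G"
  shows "(\<Oplus>k\<in>{..n}. \<Oplus>i\<in>{..k}. f i (k - i)) = (\<Oplus>i\<in>{..n::nat}. \<Oplus>j\<in>{..n - i}. f i j)"
proof (induction n)
  case 0
  then show ?case using assms by simp
next
  case (Suc n)
  have "(\<Oplus>i\<in>{..Suc n}. \<Oplus>j\<in>{..Suc n - i}. f i j)
      = f (Suc n) 0 \<oplus> (\<Oplus>i\<in>{..n}. \<Oplus>j\<in>{..Suc n - i}. f i j)"
    using assms by (simp add: Pi_def finsum_closed)
  also have "(\<Oplus>i\<in>{..n}. \<Oplus>j\<in>{..Suc n - i}. f i j)
      = (\<Oplus>i\<in>{..n}. f i (Suc n - i) \<oplus> (\<Oplus>j\<in>{..n - i}. f i j))"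
    using assms by (intro finsum_cong') (auto simp: Suc_diff_le finsum_closed)
  also have "\<dots> = (\<Oplus>i\<in>{..n}. f i (Suc n - i)) \<oplus> (\<Oplus>i\<in>{..n}. \<Oplus>j\<in>{..n - i}. f i j)"
    using assms by (intro finsum_addf) (auto simp: finsum_closed)
  finally show ?case
    using assms by (simp add: Suc.IH Pi_def finsum_closed a_assoc)
qed

lemma (in abelian_monoid) finsum_flip:
  assumes "\<And>i. f i \<in> carrier G"
  shows "(\<Oplus>k\<in>{..n}. f (n - k)) = (\<Oplus>k\<in>{..n::nat}. f k)"
proof -
  have "inj_on (\<lambda>k. n - k) {..n}" by (auto simp: inj_on_def)
  moreover have "(\<lambda>k. n - k) ` {..n} = {..n}"
    by (auto simp: image_iff) (metis atMost_iff diff_diff_cancel diff_le_self)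
  ultimately show ?thesis using finsum_reindex[of f "\<lambda>k. n - k" "{..n}"] assms by simp
qed

definition conv :: "('b, 'm) ring_scheme \<Rightarrow> (nat \<Rightarrow> 'b) \<Rightarrow> (nat \<Rightarrow> 'b) \<Rightarrow> nat \<Rightarrow> 'b" where
  "conv R a b n = (\<Oplus>\<^bsub>R\<^esub>k\<in>{..n}. a k \<otimes>\<^bsub>R\<^esub> b (n - k))"

text \<open>
  For generating series \<open>a(t)\<close> and \<open>b(t)\<close>, the coefficients of \<open>a(t/q) b(qt)\<close>: the powers
  \<open>q\<^sup>-\<^sup>k\<close> and \<open>q\<^sup>n\<^sup>-\<^sup>k\<close> combine to \<open>q\<^sup>n\<^sup>-\<^sup>2\<^sup>k\<close>.
\<close>

definition twconv ::
  "('a::field, 'b) module \<Rightarrow> 'a \<Rightarrow> (nat \<Rightarrow> 'b) \<Rightarrow> (nat \<Rightarrow> 'b) \<Rightarrow> nat \<Rightarrow> 'b" where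
  "twconv A q a b n =
    (\<Oplus>\<^bsub>A\<^esub>k\<in>{..n}. (q powi (int n - 2 * int k)) \<odot>\<^bsub>A\<^esub> (a k \<otimes>\<^bsub>A\<^esub> b (n - k)))"

text \<open>
  The terms other than \<open>k = 0\<close> and \<open>k = n\<close>; they involve only coefficients of lower index, which is
  what makes the recursions below solvable.
\<close>

definition twconv_inner ::
  "('a::field, 'b) module \<Rightarrow> 'a \<Rightarrow> (nat \<Rightarrow> 'b) \<Rightarrow> (nat \<Rightarrow> 'b) \<Rightarrow> nat \<Rightarrow> 'b" where
  "twconv_inner A q a b n =
    (\<Oplus>\<^bsub>A\<^esub>k\<in>{1..<n}. (q powi (int n - 2 * int k)) \<odot>\<^bsub>A\<^esub> (a k \<otimes>\<^bsub>A\<^esub> b (n - k)))"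

context ring
begin

lemma conv_closed [simp]:
  "\<lbrakk>\<And>n. a n \<in> carrier R; \<And>n. b n \<in> carrier R\<rbrakk> \<Longrightarrow> conv R a b n \<in> carrier R"
  by (simp add: conv_def finsum_closed Pi_def)

lemma conv_0 [simp]:
  "\<lbrakk>\<And>n. a n \<in> carrier R; \<And>n. b n \<in> carrier R\<rbrakk> \<Longrightarrow> conv R a b 0 = a 0 \<otimes> b 0"
  by (simp add: conv_def)

lemma conv_Suc:
  assumes "\<And>n. a n \<in> carrier R" "\<And>n. b n \<in> carrier R"
  shows "conv R a b (Suc n) = conv R (\<lambda>k. a (Suc k)) b n \<oplus> a 0 \<otimes> b (Suc n)"
  unfolding conv_def using assms by (subst finsum_Suc2) auto

lemma conv_assoc:
  assumes [simp]: "\<And>n. a n \<in> carrier R" "\<And>n. b n \<in> carrier R" "\<And>n. c n \<in> carrier R"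
  shows "conv R (conv R a b) c n = conv R a (conv R b c) n"
proof -
  have "conv R (conv R a b) c n
      = (\<Oplus>k\<in>{..n}. \<Oplus>i\<in>{..k}. a i \<otimes> (b (k - i) \<otimes> c (n - i - (k - i))))"
    unfolding conv_def
    by (intro finsum_cong') (auto simp: finsum_ldistr finsum_closed m_assoc intro!: finsum_cong')
  also have "\<dots> = (\<Oplus>i\<in>{..n}. \<Oplus>j\<in>{..n - i}. a i \<otimes> (b j \<otimes> c (n - i - j)))"
    by (rule finsum_triangle) simp
  also have "\<dots> = conv R a (conv R b c) n"
    unfolding conv_def by (intro finsum_cong') (auto simp: finsum_rdistr finsum_closed)
  finally show ?thesis .
qed

lemma conv_commute:
  assumes [simp]: "\<And>n. a n \<in> carrier R" "\<And>n. b n \<in> carrier R"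
    and "\<And>m n. a m \<otimes> b n = b n \<otimes> a m"
  shows "conv R a b n = conv R b a n"
proof -
  have "conv R a b n = (\<Oplus>k\<in>{..n}. (\<lambda>i. b i \<otimes> a (n - i)) (n - k))"
    unfolding conv_def by (intro finsum_cong') (auto simp: assms(3))
  also have "\<dots> = conv R b a n" unfolding conv_def by (rule finsum_flip) simp
  finally show ?thesis .
qed

lemma conv_interchange:
  assumes [simp]: "\<And>n. a n \<in> carrier R" "\<And>n. b n \<in> carrier R" "\<And>n. c n \<in> carrier R" "\<And>n. d n \<in> carrier R"
    and "\<And>m n. b m \<otimes> c n = c n \<otimes> b m"
  shows "conv R (conv R a b) (conv R c d) n = conv R (conv R a c) (conv R b d) n"
proof -
  have swap: "conv R b c = conv R c b" by (rule ext) (simp add: conv_commute assms(5))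
  have A: "conv R b (conv R c d) = conv R (conv R b c) d" by (rule ext) (simp add: conv_assoc)
  have B: "conv R c (conv R b d) = conv R (conv R c b) d" by (rule ext) (simp add: conv_assoc)
  show ?thesis by (simp add: conv_assoc A B swap)
qed

end

context assoc_alg
begin

lemma twconv_closed [simp]:
  "\<lbrakk>\<And>n. a n \<in> carrier A; \<And>n. b n \<in> carrier A\<rbrakk> \<Longrightarrow> twconv A q a b n \<in> carrier A"
  by (simp add: twconv_def finsum_closed Pi_def)

lemma twconv_0 [simp]:
  "\<lbrakk>\<And>n. a n \<in> carrier A; \<And>n. b n \<in> carrier A\<rbrakk> \<Longrightarrow> twconv A q a b 0 = a 0 \<otimes> b 0"
  by (simp add: twconv_def)

lemma twconv_eq_conv:
  assumes [simp]: "\<And>n. a n \<in> carrier A" "\<And>n. b n \<in> carrier A" and q: "q \<noteq> 0"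
  shows "twconv A q a b n = conv A (\<lambda>k. (inverse q ^ k) \<odot> a k) (\<lambda>k. (q ^ k) \<odot> b k) n"
  unfolding twconv_def conv_def
proof (intro finsum_cong')
  fix k assume "k \<in> {..n}"
  then have "q powi (int n - 2 * int k) = inverse q ^ k * q ^ (n - k)"
    using q by (auto simp: power_int_diff power_int_mult power_diff power_inverse field_simps power_mult
        power2_eq_square power_mult_distrib)
  then show "(q powi (int n - 2 * int k)) \<odot> (a k \<otimes> b (n - k))
      = ((inverse q ^ k) \<odot> a k) \<otimes> ((q ^ (n - k)) \<odot> b (n - k))"
    by (simp add: smult_assoc_left smult_assoc_right smult_smult mult.commute)
qed auto

lemma smult_conv:
  assumes [simp]: "\<And>n. a n \<in> carrier A" "\<And>n. b n \<in> carrier A"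
  shows "(c ^ n) \<odot> conv A a b n = conv A (\<lambda>k. (c ^ k) \<odot> a k) (\<lambda>k. (c ^ k) \<odot> b k) n"
  unfolding conv_def
  by (subst smult_finsum, simp)
    (auto intro!: finsum_cong' simp: smult_assoc_left smult_assoc_right smult_smult simp flip: power_add)

text \<open>
  The series identity \<open>(a Z)(t/q) (b Z)(qt) = a(t/q) b(qt) \<cdot> Z(t/q) Z(qt)\<close>, where \<open>Z(t/q)\<close> is moved
  past \<open>b(qt)\<close>.
\<close>

lemma twconv_conv:
  assumes [simp]: "\<And>n. a n \<in> carrier A" "\<And>n. b n \<in> carrier A" "\<And>n. Z n \<in> carrier A" and q: "q \<noteq> 0"
    and "\<And>m n. Z m \<otimes> b n = b n \<otimes> Z m"
  shows "twconv A q (conv A a Z) (conv A b Z) n = conv A (twconv A q a b) (twconv A q Z Z) n"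
proof -
  have "twconv A q a b = conv A (\<lambda>k. (inverse q ^ k) \<odot> a k) (\<lambda>k. (q ^ k) \<odot> b k)"
       "twconv A q Z Z = conv A (\<lambda>k. (inverse q ^ k) \<odot> Z k) (\<lambda>k. (q ^ k) \<odot> Z k)"
    by (rule ext, simp add: twconv_eq_conv q)+
  then show ?thesis
    by (simp add: twconv_eq_conv q smult_conv)
      (rule conv_interchange; simp add: smult_assoc_left smult_assoc_right smult_smult assms mult.commute)
qed

lemma conv_diff_left:
  assumes [simp]: "\<And>n. a n \<in> carrier A" "\<And>n. b n \<in> carrier A" "\<And>n. Z n \<in> carrier A"
  shows "conv A (\<lambda>k. a k \<ominus> b k) Z n = conv A a Z n \<ominus> conv A b Z n"
proof -
  have "conv A (\<lambda>k. a k \<ominus> b k) Z n \<oplus> conv A b Z n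
      = (\<Oplus>k\<in>{..n}. (a k \<ominus> b k) \<otimes> Z (n - k) \<oplus> b k \<otimes> Z (n - k))"
    unfolding conv_def by (intro finsum_addf[symmetric]) auto
  also have "\<dots> = conv A a Z n"
  proof -
    have "(a k \<ominus> b k) \<otimes> z \<oplus> b k \<otimes> z = a k \<otimes> z" if "z \<in> carrier A" for k z
      using that l_distr[of "a k \<ominus> b k" "b k" z] by (simp add: diff_add_cancel)
    then show ?thesis unfolding conv_def by (intro finsum_cong') auto
  qed
  finally have "conv A a Z n = conv A (\<lambda>k. a k \<ominus> b k) Z n \<oplus> conv A b Z n" ..
  then show ?thesis by (simp add: add_diff_cancel)
qed

lemma conv_smult_left:
  assumes [simp]: "\<And>n. a n \<in> carrier A" "\<And>n. Z n \<in> carrier A"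
  shows "conv A (\<lambda>k. c \<odot> a k) Z n = c \<odot> conv A a Z n"
  unfolding conv_def by (subst smult_finsum) (auto intro!: finsum_cong' simp: smult_assoc_left)

lemma mult_conv:
  assumes [simp]: "x \<in> carrier A" "\<And>n. a n \<in> carrier A" "\<And>n. Z n \<in> carrier A"
  shows "x \<otimes> conv A a Z n = conv A (\<lambda>k. x \<otimes> a k) Z n"
  unfolding conv_def by (subst finsum_rdistr) (auto intro!: finsum_cong' simp: m_assoc)

lemma conv_mult:
  assumes [simp]: "x \<in> carrier A" "\<And>n. a n \<in> carrier A" "\<And>n. Z n \<in> carrier A"
    and "\<And>n. Z n \<otimes> x = x \<otimes> Z n"
  shows "conv A a Z n \<otimes> x = conv A (\<lambda>k. a k \<otimes> x) Z n"
  unfolding conv_def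
  by (subst finsum_ldistr) (auto intro!: finsum_cong' simp: m_assoc assms(4))

lemma twconv_inner_closed [simp]:
  "\<lbrakk>\<And>n. a n \<in> carrier A; \<And>n. b n \<in> carrier A\<rbrakk> \<Longrightarrow> twconv_inner A q a b n \<in> carrier A"
  by (simp add: twconv_inner_def finsum_closed Pi_def)

lemma twconv_inner_cong:
  assumes "\<And>n. a n \<in> carrier A" "\<And>n. b n \<in> carrier A"
    and "\<And>k. k < n \<Longrightarrow> a' k = a k" "\<And>k. k < n \<Longrightarrow> b' k = b k"
  shows "twconv_inner A q a' b' n = twconv_inner A q a b n"
  unfolding twconv_inner_def using assms by (intro finsum_cong') auto

lemma twconv_ends:
  assumes [simp]: "\<And>n. a n \<in> carrier A" "\<And>n. b n \<in> carrier A"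
    and 0: "a 0 = \<one>" "b 0 = \<one>" and n: "n \<ge> 1"
  shows "twconv A q a b n =
    ((q powi int n) \<odot> b n \<oplus> (q powi (- int n)) \<odot> a n) \<oplus> twconv_inner A q a b n"
proof -
  have "{..n} = insert 0 (insert n {1..<n})" using n by auto
  then show ?thesis
    using n unfolding twconv_def twconv_inner_def by (simp add: 0 Pi_def finsum_closed a_assoc)
qed

lemma solve_two_by_two:
  assumes c: "a + b \<noteq> 0"
    and [simp]: "u \<in> carrier A" "v \<in> carrier A" "u' \<in> carrier A" "v' \<in> carrier A"
    and sum: "a \<odot> u \<oplus> b \<odot> v = a \<odot> u' \<oplus> b \<odot> v'" and diff: "u \<ominus> v = u' \<ominus> v'"
  shows "u = u' \<and> v = v'"
proof -
  have *: "a \<odot> x \<oplus> b \<odot> y = a \<odot> (x \<ominus> y) \<oplus> (a + b) \<odot> y"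
    if [simp]: "x \<in> carrier A" "y \<in> carrier A" for x y
  proof -
    have "a \<odot> x = a \<odot> (x \<ominus> y) \<oplus> a \<odot> y"
      using smult_r_distr[of "x \<ominus> y" y a] by (simp add: diff_add_cancel)
    then show ?thesis by (simp add: smult_l_distr a_assoc)
  qed
  have "(a + b) \<odot> v = (a + b) \<odot> v'"
    using sum by (simp add: * diff)
  then have "v = v'" using smult_left_cancel[OF c] by simp
  moreover have "u = (u \<ominus> v) \<oplus> v" "u' = (u' \<ominus> v') \<oplus> v'" by (simp_all add: diff_add_cancel)
  ultimately show ?thesis using diff by simp
qed

end


section \<open>Alternating systems\<close>

lemma q_power_sum_nonzero:
  fixes q :: "'a::field"
  assumes "q \<noteq> 0" "\<And>n::nat. n \<ge> 1 \<Longrightarrow> q ^ n \<noteq> 1" and n: "n \<ge> 1"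
  shows "q powi int n + q powi (- int n) \<noteq> 0"
proof
  assume "q powi int n + q powi (- int n) = 0"
  then have "q ^ n * q ^ n = - 1"
    using assms(1) by (simp add: power_int_minus field_simps add_eq_0_iff)
  (* q^(2n) = -1 would make q a root of unity of order dividing 4n. *)
  moreover have "q ^ (4 * n) = (q ^ n * q ^ n) * (q ^ n * q ^ n)"
    by (metis power_add mult_2 numeral_Bit0 distrib_right)
  ultimately have "q ^ (4 * n) = 1" by simp
  with assms(2)[of "4 * n"] n show False by simp
qed

locale generic_alg = assoc_alg A for A :: "('a::field, 'b) module" (structure) +
  fixes q :: 'a
  assumes q_nonzero: "q \<noteq> 0"
    and q_not_root_of_unity: "n \<ge> 1 \<Longrightarrow> q ^ n \<noteq> 1"
begin

text \<open>
  The series \<open>Z(t/q) Z(qt)\<close> determines \<open>Z\<close>: its \<open>n\<close>-th coefficient is \<open>(q\<^sup>n + q\<^sup>-\<^sup>n) Z\<^sub>n\<close> plus terms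
  in lower coefficients.
\<close>

lemma twconv_self_inj:
  assumes [simp]: "\<And>n. Z n \<in> carrier A" "\<And>n. Y n \<in> carrier A" and 0: "Z 0 = \<one>" "Y 0 = \<one>"
    and eq: "\<And>n. twconv A q Z Z n = twconv A q Y Y n"
  shows "Z n = Y n"
proof (induction n rule: less_induct)
  case (less n)
  show ?case
  proof (cases n)
    case (Suc m)
    then have n: "n \<ge> 1" by simp
    have M: "twconv_inner A q Z Z n = twconv_inner A q Y Y n"
      by (intro twconv_inner_cong) (auto simp: less.IH)
    have "(q powi int n + q powi (- int n)) \<odot> Z n \<oplus> twconv_inner A q Y Y n
        = (q powi int n + q powi (- int n)) \<odot> Y n \<oplus> twconv_inner A q Y Y n"
      using eq[of n] n by (simp add: twconv_ends 0 smult_l_distr M)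
    then have "(q powi int n + q powi (- int n)) \<odot> Z n = (q powi int n + q powi (- int n)) \<odot> Y n"
      by simp
    then show ?thesis
      using smult_left_cancel[OF q_power_sum_nonzero[of q n, OF q_nonzero q_not_root_of_unity]] Suc
      by simp
  qed (simp add: 0)
qed

end

text \<open>
  \<open>Wm n\<close>, \<open>Wp n\<close>, \<open>G n\<close>, \<open>Gt n\<close> play the roles of \<open>W\<^bsub>-n\<^esub>\<close>, \<open>W\<^bsub>n+1\<^esub>\<close>, \<open>G\<^sub>n\<close> and \<open>G'\<^sub>n\<close>. The index shift
  between the two products in \<open>vee\<close> is the factor \<open>t\<close> in
  \<open>G(t/q) G'(qt) - q t W\<^sup>-(t/q) W\<^sup>+(qt) = D(t)\<close>.
\<close>

locale alternating_system = generic_alg A q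
  for A :: "('a::field, 'b) module" (structure) and q +
  fixes Wm Wp G Gt D :: "nat \<Rightarrow> 'b"
  assumes closed [simp]: "Wm n \<in> carrier A" "Wp n \<in> carrier A" "G n \<in> carrier A" "Gt n \<in> carrier A"
    and zeroth: "G 0 = \<one>" "Gt 0 = \<one>" "D 0 = \<one>"
    and comm_Wm_Wp: "comm A (Wm 0) (Wp n) = (1 - q powi (- 2)) \<odot> (Gt (Suc n) \<ominus> G (Suc n))"
    and qcomm_Wm_G: "qcomm A q (Wm 0) (G n) = (q - inverse q) \<odot> Wm n"
    and qcomm_G_Wp: "qcomm A q (G n) (Wp 0) = (q - inverse q) \<odot> Wp n"
    and vee: "twconv A q G Gt (Suc n) \<ominus> q \<odot> twconv A q Wm Wp n = D (Suc n)"

text \<open>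
  In degree \<open>n\<close> the commutator of \<open>W\<^sub>0\<close> with \<open>W\<^sub>n\<close> gives \<open>G'\<^sub>n - G\<^sub>n\<close>, and the defect gives
  \<open>q\<^sup>n G'\<^sub>n + q\<^sup>-\<^sup>n G\<^sub>n\<close>, both in terms of elements already known. This linear system has determinant
  \<open>\<plusminus>(q\<^sup>n + q\<^sup>-\<^sup>n)\<close> and so fixes \<open>G\<^sub>n\<close> and \<open>G'\<^sub>n\<close>, and then \<open>G\<^sub>n\<close> fixes \<open>W\<^bsub>-n\<^esub>\<close> and \<open>W\<^bsub>n+1\<^esub>\<close>.
\<close>

lemma (in alternating_system) unique:
  assumes "alternating_system A q Wm' Wp' G' Gt' D"
    and 0: "Wm' 0 = Wm 0" "Wp' 0 = Wp 0"
  shows "Wm' n = Wm n \<and> Wp' n = Wp n \<and> G' n = G n \<and> Gt' n = Gt n"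
proof -
  interpret X: alternating_system A q Wm' Wp' G' Gt' D by fact
  have q2: "q - inverse q \<noteq> 0" "1 - q powi (- 2) \<noteq> 0"
    using q_nonzero q_not_root_of_unity[of 2] by (auto simp: field_simps power2_eq_square power_int_minus)
  show ?thesis
  proof (induction n rule: less_induct)
    case (less n)
    show ?case
    proof (cases n)
      case (Suc m)
      then have n: "n \<ge> 1" by simp
      have M: "twconv_inner A q G' Gt' n = twconv_inner A q G Gt n"
        by (intro twconv_inner_cong) (auto simp: less.IH)
      have W: "twconv A q Wm' Wp' m = twconv A q Wm Wp m"
        unfolding twconv_def by (intro finsum_cong') (auto simp: less.IH Suc)
      have "twconv A q G' Gt' n \<ominus> q \<odot> twconv A q Wm Wp m = twconv A q G Gt n \<ominus> q \<odot> twconv A q Wm Wp m"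
        using vee[of m] X.vee[of m] W Suc by simp
      then have "twconv A q G' Gt' n = twconv A q G Gt n"
        by (simp add: minus_eq)
      then have "(q powi int n) \<odot> Gt' n \<oplus> (q powi (- int n)) \<odot> G' n
          = (q powi int n) \<odot> Gt n \<oplus> (q powi (- int n)) \<odot> G n"
        using n by (simp add: twconv_ends zeroth X.zeroth M)
      moreover have "Gt' n \<ominus> G' n = Gt n \<ominus> G n"
      proof -
        have "(1 - q powi (- 2)) \<odot> (Gt' n \<ominus> G' n) = (1 - q powi (- 2)) \<odot> (Gt n \<ominus> G n)"
          using comm_Wm_Wp[of m] X.comm_Wm_Wp[of m] less.IH[of m] by (simp add: 0 Suc)
        then show ?thesis using smult_left_cancel[OF q2(2)] by simp
      qed
      moreover have "q powi int n + q powi (- int n) \<noteq> 0"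
        using q_power_sum_nonzero[of q n] q_nonzero q_not_root_of_unity Suc by simp
      ultimately have GGt: "Gt' n = Gt n \<and> G' n = G n"
        by (intro solve_two_by_two[of "q powi int n" "q powi (- int n)"]) auto
      have "Wm' n = Wm n"
        using qcomm_Wm_G[of n] X.qcomm_Wm_G[of n] smult_left_cancel[OF q2(1)] GGt 0 by simp
      moreover have "Wp' n = Wp n"
        using qcomm_G_Wp[of n] X.qcomm_G_Wp[of n] smult_left_cancel[OF q2(1)] GGt 0 by simp
      ultimately show ?thesis using GGt by simp
    qed (simp add: 0 zeroth X.zeroth)
  qed
qed

text \<open>
  The commutator relations are linear over series that commute with \<open>W\<^sub>0\<close> and \<open>W\<^sub>1\<close>, and in the
  quadratic relation the factor \<open>Z(t/q) Z(qt)\<close> splits off by \<open>twconv_conv\<close>.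
\<close>

lemma (in alternating_system) conv_system:
  assumes D: "\<And>n. D (Suc n) = \<zero>"
    and Z [simp]: "\<And>n. Z n \<in> carrier A" and Z0: "Z 0 = \<one>"
    and Z_comm: "\<And>n. Z n \<otimes> Wm 0 = Wm 0 \<otimes> Z n" "\<And>m n. Z m \<otimes> Wp n = Wp n \<otimes> Z m"
      "\<And>m n. Z m \<otimes> Gt n = Gt n \<otimes> Z m"
  shows "alternating_system A q (conv A Wm Z) (conv A Wp Z) (conv A G Z) (conv A Gt Z) (twconv A q Z Z)"
proof
  fix n
  show "comm A (conv A Wm Z 0) (conv A Wp Z n)
      = (1 - q powi (- 2)) \<odot> (conv A Gt Z (Suc n) \<ominus> conv A G Z (Suc n))"
  proof -
    have "comm A (conv A Wm Z 0) (conv A Wp Z n) = conv A (\<lambda>k. comm A (Wm 0) (Wp k)) Z n"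
      by (simp add: comm_def Z0 mult_conv conv_mult Z_comm conv_diff_left)
    also have "\<dots> = (1 - q powi (- 2)) \<odot>
        (conv A (\<lambda>k. Gt (Suc k)) Z n \<ominus> conv A (\<lambda>k. G (Suc k)) Z n)"
      by (simp only: comm_Wm_Wp) (simp add: conv_smult_left conv_diff_left)
    also have "conv A (\<lambda>k. Gt (Suc k)) Z n \<ominus> conv A (\<lambda>k. G (Suc k)) Z n
        = conv A Gt Z (Suc n) \<ominus> conv A G Z (Suc n)"
      by (simp add: conv_Suc zeroth add_diff_add_cancel)
    finally show ?thesis .
  qed
  show "qcomm A q (conv A Wm Z 0) (conv A G Z n) = (q - inverse q) \<odot> conv A Wm Z n"
  proof -
    have "qcomm A q (conv A Wm Z 0) (conv A G Z n) = conv A (\<lambda>k. qcomm A q (Wm 0) (G k)) Z n"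
      by (simp add: qcomm_def Z0 mult_conv conv_mult Z_comm conv_diff_left conv_smult_left)
    then show ?thesis by (simp add: qcomm_Wm_G conv_smult_left)
  qed
  show "qcomm A q (conv A G Z n) (conv A Wp Z 0) = (q - inverse q) \<odot> conv A Wp Z n"
  proof -
    have "qcomm A q (conv A G Z n) (conv A Wp Z 0) = conv A (\<lambda>k. qcomm A q (G k) (Wp 0)) Z n"
      by (simp add: qcomm_def Z0 mult_conv conv_mult Z_comm conv_diff_left conv_smult_left)
    then show ?thesis by (simp add: qcomm_G_Wp conv_smult_left)
  qed
  show "twconv A q (conv A G Z) (conv A Gt Z) (Suc n) \<ominus> q \<odot> twconv A q (conv A Wm Z) (conv A Wp Z) n
      = twconv A q Z Z (Suc n)"
  proof -
    let ?V = "twconv A q Wm Wp" and ?E = "twconv A q Z Z"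
    let ?V' = "twconv A q (conv A Wm Z) (conv A Wp Z)"
    (* The defect of the given system is 1, so its two products agree in positive degree. *)
    have S: "twconv A q G Gt (Suc k) = q \<odot> ?V k" for k
      using diff_add_cancel[of "twconv A q G Gt (Suc k)" "q \<odot> ?V k"] vee[of k] by (simp add: D)
    have "twconv A q (conv A G Z) (conv A Gt Z) (Suc n) = conv A (twconv A q G Gt) ?E (Suc n)"
      by (simp add: twconv_conv q_nonzero Z_comm)
    also have "\<dots> = q \<odot> conv A ?V ?E n \<oplus> ?E (Suc n)"
      by (simp add: conv_Suc S conv_smult_left zeroth)
    also have "conv A ?V ?E n = ?V' n"
      by (simp add: twconv_conv q_nonzero Z_comm)
    finally show ?thesis
      using add_diff_cancel[of "?E (Suc n)" "q \<odot> ?V' n"] a_comm[of "?E (Suc n)" "q \<odot> ?V' n"]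
      by simp
  qed
qed (simp_all add: zeroth Z0)

context assoc_alg_hom
begin

lemma hom_twconv:
  assumes [simp]: "\<And>n. a n \<in> carrier A" "\<And>n. b n \<in> carrier A"
  shows "h (twconv A q a b n) = twconv B q (\<lambda>k. h (a k)) (\<lambda>k. h (b k)) n"
  unfolding twconv_def by (subst hom_finsum) (auto intro!: B.finsum_cong')

lemma hom_alternating_system:
  assumes "alternating_system A q Wm Wp G Gt D"
  shows "alternating_system B q (\<lambda>n. h (Wm n)) (\<lambda>n. h (Wp n)) (\<lambda>n. h (G n)) (\<lambda>n. h (Gt n)) (\<lambda>n. h (D n))"
proof -
  interpret X: alternating_system A q Wm Wp G Gt D by fact
  show ?thesis
  proof
    fix n
    show "comm B (h (Wm 0)) (h (Wp n)) = (1 - q powi (- 2)) \<odot>\<^bsub>B\<^esub> (h (Gt (Suc n)) \<ominus>\<^bsub>B\<^esub> h (G (Suc n)))"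
      using arg_cong[OF X.comm_Wm_Wp[of n], of h] by simp
    show "qcomm B q (h (Wm 0)) (h (G n)) = (q - inverse q) \<odot>\<^bsub>B\<^esub> h (Wm n)"
      using arg_cong[OF X.qcomm_Wm_G[of n], of h] by simp
    show "qcomm B q (h (G n)) (h (Wp 0)) = (q - inverse q) \<odot>\<^bsub>B\<^esub> h (Wp n)"
      using arg_cong[OF X.qcomm_G_Wp[of n], of h] by simp
    show "twconv B q (\<lambda>n. h (G n)) (\<lambda>n. h (Gt n)) (Suc n)
        \<ominus>\<^bsub>B\<^esub> q \<odot>\<^bsub>B\<^esub> twconv B q (\<lambda>n. h (Wm n)) (\<lambda>n. h (Wp n)) n = h (D (Suc n))"
      using arg_cong[OF X.vee[of n], of h] by (simp add: hom_twconv)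
  qed (use X.q_nonzero X.q_not_root_of_unity in \<open>auto simp: X.zeroth\<close>)
qed

end

section \<open>Monoid algebras\<close>

text \<open>
  By this rule, identities between additive expressions, such as associativity in a monoid algebra,
  need to be checked on multiples of basis elements only.
\<close>

lemma poly_mapping_additive_induct [consumes 1, case_names zero single add]:
  fixes p :: "'x \<Rightarrow>\<^sub>0 'c::comm_monoid_add"
  assumes "Poly_Mapping.keys p \<subseteq> S" and zero: "P 0"
    and single: "\<And>x c. x \<in> S \<Longrightarrow> P (Poly_Mapping.single x c)"
    and add: "\<And>p r. \<lbrakk>P p; P r\<rbrakk> \<Longrightarrow> P (p + r)"
  shows "P p"
proof -
  have "P (\<Sum>x\<in>T. Poly_Mapping.single x (Poly_Mapping.lookup p x))" if "finite T" "T \<subseteq> S" for T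
    using that by (induction T rule: finite_induct) (auto intro: zero single add)
  moreover have "(\<Sum>x\<in>Poly_Mapping.keys p. Poly_Mapping.single x (Poly_Mapping.lookup p x)) = p"
    by (rule poly_mapping_eqI)
      (simp add: lookup_sum lookup_single when_def in_keys_iff)
  ultimately show ?thesis using assms(1) by (metis finite_keys)
qed

lemma lookup_scale: "Poly_Mapping.lookup (Poly_Mapping.map ((*) c) p) x = c * Poly_Mapping.lookup p x"
  for c :: "'a::field"
  by (simp add: Poly_Mapping.map.rep_eq when_def)

lemma monoid_alg_simps:
  "carrier (monoid_alg M) = {p. Poly_Mapping.keys p \<subseteq> carrier M}"
  "one (monoid_alg M) = Poly_Mapping.single \<one>\<^bsub>M\<^esub> 1"
  "zero (monoid_alg M) = 0" "add (monoid_alg M) = (+)"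
  "smult (monoid_alg M) = (\<lambda>c. Poly_Mapping.map ((*) c))"
  by (simp_all add: monoid_alg_def)

lemma monoid_alg_mult_single:
  "mult (monoid_alg M) (Poly_Mapping.single x c) (Poly_Mapping.single y d)
    = Poly_Mapping.single (x \<otimes>\<^bsub>M\<^esub> y) (c * d)"
  by (simp add: monoid_alg_def)

lemma monoid_alg_mult_zero:
  "mult (monoid_alg M) 0 p = 0" "mult (monoid_alg M) p 0 = 0"
  by (simp_all add: monoid_alg_def)

lemma monoid_alg_mult_add_left:
  "mult (monoid_alg M) (p + p') r = mult (monoid_alg M) p r + mult (monoid_alg M) p' r"
  unfolding monoid_alg_def
  by simp (rule setsum_keys_plus_distrib; simp add: single_add distrib_right sum.distrib)

lemma monoid_alg_mult_add_right:
  "mult (monoid_alg M) p (r + r') = mult (monoid_alg M) p r + mult (monoid_alg M) p r'"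
  unfolding monoid_alg_def
  by (simp add: sum.distrib[symmetric])
    (intro sum.cong refl setsum_keys_plus_distrib; simp add: single_add distrib_left)

lemma scale_zero [simp]: "Poly_Mapping.map ((*) c) 0 = 0" for c :: "'a::field"
  by (rule poly_mapping_eqI) (simp add: lookup_scale)

lemma scale_add:
  "Poly_Mapping.map ((*) c) (p + r) = Poly_Mapping.map ((*) c) p + Poly_Mapping.map ((*) c) r"
  for c :: "'a::field"
  by (rule poly_mapping_eqI) (simp add: lookup_scale lookup_add distrib_left)

lemma monoid_alg_mult_closed:
  assumes "monoid M" "p \<in> carrier (monoid_alg M)" "r \<in> carrier (monoid_alg M)"
  shows "mult (monoid_alg M) p r \<in> carrier (monoid_alg M)"
proof -
  interpret monoid M by fact
  have add: "p + r \<in> carrier (monoid_alg M)"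
    if "p \<in> carrier (monoid_alg M)" "r \<in> carrier (monoid_alg M)" for p r
    using that keys_add[of p r] by (auto simp: monoid_alg_simps)
  have p: "Poly_Mapping.keys p \<subseteq> carrier M" and r: "Poly_Mapping.keys r \<subseteq> carrier M"
    using assms by (auto simp: monoid_alg_simps)
  from p show ?thesis
  proof (induction rule: poly_mapping_additive_induct)
    case (single x c)
    from r show ?case
      by (induction rule: poly_mapping_additive_induct)
        (use single in \<open>simp_all add: monoid_alg_mult_add_right monoid_alg_mult_single
           monoid_alg_mult_zero add\<close>, auto simp: monoid_alg_simps)
  qed (simp_all add: monoid_alg_mult_zero monoid_alg_mult_add_left add, simp add: monoid_alg_simps)
qed

lemma monoid_alg_mult_assoc:
  assumes "monoid M" "p \<in> carrier (monoid_alg M)" "r \<in> carrier (monoid_alg M)"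
    "s \<in> carrier (monoid_alg M)"
  shows "mult (monoid_alg M) (mult (monoid_alg M) p r) s = mult (monoid_alg M) p (mult (monoid_alg M) r s)"
proof -
  interpret monoid M by fact
  note simps = monoid_alg_mult_zero monoid_alg_mult_add_left monoid_alg_mult_add_right
    monoid_alg_mult_single
  have p: "Poly_Mapping.keys p \<subseteq> carrier M" and r: "Poly_Mapping.keys r \<subseteq> carrier M"
    and s: "Poly_Mapping.keys s \<subseteq> carrier M"
    using assms by (auto simp: monoid_alg_simps)
  from p show ?thesis
  proof (induction rule: poly_mapping_additive_induct)
    case (single x c)
    from r show ?case
    proof (induction rule: poly_mapping_additive_induct)
      case (single y d)
      from s show ?case
        by (induction rule: poly_mapping_additive_induct)
          (use single \<open>x \<in> carrier M\<close> in \<open>simp_all add: simps m_assoc mult.assoc\<close>)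
    qed (simp_all add: simps)
  qed (simp_all add: simps)
qed

lemma monoid_alg_is_alg:
  assumes "monoid M"
  shows "assoc_alg (monoid_alg M :: ('a::field, 'm \<Rightarrow>\<^sub>0 'a) module)"
proof -
  interpret M: monoid M by fact
  let ?A = "monoid_alg M :: ('a, 'm \<Rightarrow>\<^sub>0 'a) module"
  have keys: "p \<in> carrier ?A \<longleftrightarrow> Poly_Mapping.keys p \<subseteq> carrier M" for p
    by (simp add: monoid_alg_simps)
  have add: "p + r \<in> carrier ?A" if "p \<in> carrier ?A" "r \<in> carrier ?A" for p r
    using that keys_add[of p r] by (auto simp: keys)
  have one_left: "mult ?A (Poly_Mapping.single \<one>\<^bsub>M\<^esub> 1) p = p" if "p \<in> carrier ?A" for p
    using that unfolding keys
    by (induction rule: poly_mapping_additive_induct)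
      (simp_all add: monoid_alg_mult_zero monoid_alg_mult_add_right monoid_alg_mult_single)
  have one_right: "mult ?A p (Poly_Mapping.single \<one>\<^bsub>M\<^esub> 1) = p" if "p \<in> carrier ?A" for p
    using that unfolding keys
    by (induction rule: poly_mapping_additive_induct)
      (simp_all add: monoid_alg_mult_zero monoid_alg_mult_add_left monoid_alg_mult_single)
  have scale_mult: "mult ?A (Poly_Mapping.map ((*) c) p) r = Poly_Mapping.map ((*) c) (mult ?A p r)
      \<and> mult ?A p (Poly_Mapping.map ((*) c) r) = Poly_Mapping.map ((*) c) (mult ?A p r)" for c p r
  proof (rule conjI; rule poly_mapping_additive_induct[OF subset_UNIV, of _ p])
    fix x d
    show "mult ?A (Poly_Mapping.map ((*) c) (Poly_Mapping.single x d)) r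
        = Poly_Mapping.map ((*) c) (mult ?A (Poly_Mapping.single x d) r)"
      by (rule poly_mapping_additive_induct[OF subset_UNIV, of _ r])
        (simp_all add: monoid_alg_mult_zero monoid_alg_mult_add_right monoid_alg_mult_single
          scale_add mult.assoc)
    show "mult ?A (Poly_Mapping.single x d) (Poly_Mapping.map ((*) c) r)
        = Poly_Mapping.map ((*) c) (mult ?A (Poly_Mapping.single x d) r)"
      by (rule poly_mapping_additive_induct[OF subset_UNIV, of _ r])
        (simp_all add: monoid_alg_mult_zero monoid_alg_mult_add_right monoid_alg_mult_single
          scale_add mult.left_commute[of d c])
  qed (simp_all add: monoid_alg_mult_zero monoid_alg_mult_add_left scale_add)
  have "ring ?A"
  proof (rule ringI)
    show "abelian_group ?A"
    proof (rule abelian_groupI)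
      fix p assume "p \<in> carrier ?A"
      then show "\<exists>r\<in>carrier ?A. r \<oplus>\<^bsub>?A\<^esub> p = \<zero>\<^bsub>?A\<^esub>"
        by (intro bexI[of _ "- p"]) (simp_all add: monoid_alg_simps)
    qed (use add in \<open>simp_all add: monoid_alg_simps add_ac\<close>)
    show "monoid ?A"
      by (rule monoidI)
        (simp_all add: monoid_alg_simps(2) one_left one_right monoid_alg_mult_closed
          monoid_alg_mult_assoc assms, simp add: monoid_alg_simps)
  qed (simp_all add: monoid_alg_mult_add_left monoid_alg_mult_add_right monoid_alg_simps(4))
  then interpret ring ?A .
  show ?thesis
  proof
    fix p c assume "p \<in> carrier ?A"
    then show "c \<odot>\<^bsub>?A\<^esub> p \<in> carrier ?A"
      by (auto simp: monoid_alg_simps in_keys_iff lookup_scale)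
    show "1 \<odot>\<^bsub>?A\<^esub> p = p"
      by (rule poly_mapping_eqI) (simp add: monoid_alg_simps lookup_scale)
    fix d
    show "(c + d) \<odot>\<^bsub>?A\<^esub> p = c \<odot>\<^bsub>?A\<^esub> p \<oplus>\<^bsub>?A\<^esub> d \<odot>\<^bsub>?A\<^esub> p"
      by (rule poly_mapping_eqI) (simp add: monoid_alg_simps lookup_scale lookup_add distrib_right)
    show "c \<odot>\<^bsub>?A\<^esub> (d \<odot>\<^bsub>?A\<^esub> p) = (c * d) \<odot>\<^bsub>?A\<^esub> p"
      by (rule poly_mapping_eqI) (simp add: monoid_alg_simps lookup_scale mult.assoc)
  qed (simp_all add: monoid_alg_simps(4,5) scale_add scale_mult)
qed

lemma alg_hom_monoid_alg_eqI:
  fixes B :: "('a::field, 'c) module"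
  assumes M: "monoid M" and B: "assoc_alg B"
    and h: "h \<in> alg_hom (monoid_alg M) B" and h': "h' \<in> alg_hom (monoid_alg M) B"
    and eq: "\<And>x. x \<in> carrier M \<Longrightarrow> h (Poly_Mapping.single x 1) = h' (Poly_Mapping.single x 1)"
    and p: "p \<in> carrier (monoid_alg M)"
  shows "h p = h' p"
proof -
  let ?A = "monoid_alg M :: ('a, 'b \<Rightarrow>\<^sub>0 'a) module"
  interpret B: assoc_alg B by fact
  interpret A: assoc_alg ?A by (rule monoid_alg_is_alg[OF M])
  interpret h: assoc_alg_hom ?A B h by unfold_locales (rule h)
  interpret h': assoc_alg_hom ?A B h' by unfold_locales (rule h')
  have "Poly_Mapping.keys p \<subseteq> carrier M" using p by (simp add: monoid_alg_simps)
  then have "p \<in> carrier ?A \<and> h p = h' p"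
  proof (induction rule: poly_mapping_additive_induct)
    case zero
    show ?case using h.hom_zero h'.hom_zero A.zero_closed unfolding monoid_alg_simps(3) by simp
  next
    case (single x c)
    then have 1: "Poly_Mapping.single x 1 \<in> carrier ?A" by (simp add: monoid_alg_simps)
    have "Poly_Mapping.single x c = c \<odot>\<^bsub>?A\<^esub> Poly_Mapping.single x 1" by (simp add: monoid_alg_simps)
    then show ?case using 1 single eq h.hom_smult[OF 1] h'.hom_smult[OF 1] A.smult_closed[OF 1] by simp
  next
    case (add p r)
    then show ?case
      using A.a_closed[of p r] h.hom_add[of p r] h'.hom_add[of p r] unfolding monoid_alg_simps(4)
      by simp
  qed
  then show ?thesis ..
qed

section \<open>Quotients and presentations\<close>

lemma ring_record_cong:
  assumes "ring R" and S: "carrier S = carrier R" "mult S = mult R" "one S = one R" "zero S = zero R" "add S = add R"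
  shows "ring S"
proof -
  interpret ring R by fact
  show ?thesis
    by (intro ringI abelian_groupI monoidI)
      (auto simp: S a_ac m_assoc l_distr r_distr intro: l_neg)
qed

lemma quot_alg_simps:
  "carrier (quot_alg A I) = carrier (A Quot I)" "mult (quot_alg A I) = mult (A Quot I)"
  "one (quot_alg A I) = one (A Quot I)" "zero (quot_alg A I) = zero (A Quot I)"
  "add (quot_alg A I) = add (A Quot I)"
  by (simp_all add: quot_alg_def)

lemma carrier_quot_alg: "carrier (quot_alg A I) = (\<lambda>x. I +>\<^bsub>A\<^esub> x) ` carrier A"
  by (auto simp: quot_alg_simps FactRing_simps)

text \<open>
  For \<open>c \<noteq> 0\<close> the set \<open>c (I + x)\<close> is itself the coset of \<open>c x\<close>; for \<open>c = 0\<close> it is \<open>{0}\<close>, which the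
  summand \<open>I\<close> in the scalar multiplication of the quotient enlarges to the coset \<open>I\<close>.
\<close>

lemma smult_coset:
  assumes "assoc_alg A" "ideal I A" and x: "x \<in> carrier A"
  shows "c \<odot>\<^bsub>quot_alg A I\<^esub> (I +>\<^bsub>A\<^esub> x) = I +>\<^bsub>A\<^esub> (c \<odot>\<^bsub>A\<^esub> x)"
proof -
  interpret assoc_alg A by fact
  interpret I: ideal I A by fact
  have "c \<odot>\<^bsub>A\<^esub> j \<in> I" if "j \<in> I" for j
    using that I.I_l_closed[of j "c \<odot>\<^bsub>A\<^esub> \<one>\<^bsub>A\<^esub>"] I.a_Hcarr by (simp add: smult_assoc_left)
  then have 1: "\<exists>k\<in>I. i \<oplus>\<^bsub>A\<^esub> c \<odot>\<^bsub>A\<^esub> (j \<oplus>\<^bsub>A\<^esub> x) = k \<oplus>\<^bsub>A\<^esub> c \<odot>\<^bsub>A\<^esub> x" if "i \<in> I" "j \<in> I" for i j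
    using that x
    by (intro bexI[of _ "i \<oplus>\<^bsub>A\<^esub> c \<odot>\<^bsub>A\<^esub> j"]) (simp_all add: I.a_Hcarr smult_r_distr a_assoc)
  have coset: "y \<in> I +>\<^bsub>A\<^esub> z \<longleftrightarrow> (\<exists>i\<in>I. y = i \<oplus>\<^bsub>A\<^esub> z)" for y z
    by (auto simp: a_r_coset_def')
  have smult: "y \<in> c \<odot>\<^bsub>quot_alg A I\<^esub> (I +>\<^bsub>A\<^esub> x)
      \<longleftrightarrow> (\<exists>i\<in>I. \<exists>j\<in>I. y = i \<oplus>\<^bsub>A\<^esub> c \<odot>\<^bsub>A\<^esub> (j \<oplus>\<^bsub>A\<^esub> x))" for y
    by (auto simp: quot_alg_def set_add_defs a_r_coset_def')
  have 2: "\<exists>j\<in>I. i \<oplus>\<^bsub>A\<^esub> c \<odot>\<^bsub>A\<^esub> x = i \<oplus>\<^bsub>A\<^esub> c \<odot>\<^bsub>A\<^esub> (j \<oplus>\<^bsub>A\<^esub> x)" for i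
    using x by (intro bexI[of _ "\<zero>\<^bsub>A\<^esub>"]) simp_all
  show ?thesis
  proof (intro subset_antisym subsetI)
    fix y assume "y \<in> c \<odot>\<^bsub>quot_alg A I\<^esub> (I +>\<^bsub>A\<^esub> x)"
    then show "y \<in> I +>\<^bsub>A\<^esub> c \<odot>\<^bsub>A\<^esub> x" unfolding smult coset using 1 by blast
  next
    fix y assume "y \<in> I +>\<^bsub>A\<^esub> c \<odot>\<^bsub>A\<^esub> x"
    then show "y \<in> c \<odot>\<^bsub>quot_alg A I\<^esub> (I +>\<^bsub>A\<^esub> x)" unfolding smult coset using 2 by blast
  qed
qed

lemma quot_alg_is_alg:
  assumes "assoc_alg A" "ideal I A"
  shows "assoc_alg (quot_alg A I)"
proof -
  interpret assoc_alg A by fact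
  interpret I: ideal I A by fact
  interpret Q: ring "quot_alg A I"
    by (rule ring_record_cong[OF I.quotient_is_ring]) (simp_all add: quot_alg_simps)
  note proj = ring_hom_mult[OF I.rcos_ring_hom] ring_hom_add[OF I.rcos_ring_hom]
  show ?thesis
    by unfold_locales
      (auto simp: carrier_quot_alg smult_coset[OF assms] smult_l_distr smult_r_distr smult_smult
        smult_assoc_left smult_assoc_right quot_alg_simps(2,5) simp flip: proj)
qed

lemma coset_alg_hom:
  assumes "assoc_alg A" "ideal I A"
  shows "(\<lambda>x. I +>\<^bsub>A\<^esub> x) \<in> alg_hom A (quot_alg A I)"
proof -
  have "(\<lambda>x. I +>\<^bsub>A\<^esub> x) \<in> ring_hom A (A Quot I)"
    by (rule ideal.rcos_ring_hom[OF assms(2)])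
  then show ?thesis
    using smult_coset[OF assms] by (simp add: alg_hom_def ring_hom_def quot_alg_simps)
qed

lemma free_alg_is_alg: "assoc_alg free_alg"
  unfolding free_alg_def by (intro monoid_alg_is_alg monoidI) auto

lemma carrier_free_alg [simp]: "x \<in> carrier free_alg"
  by (simp add: free_alg_def monoid_alg_def)

lemma alg_hom_free_alg_eqI:
  fixes h :: "('g list \<Rightarrow>\<^sub>0 'a::field) \<Rightarrow> 'c"
  assumes B: "assoc_alg B" and h: "h \<in> alg_hom free_alg B" and h': "h' \<in> alg_hom free_alg B"
    and eq: "\<And>g. h (free_gen g) = h' (free_gen g)"
  shows "h p = h' p"
proof -
  interpret B: assoc_alg B by fact
  interpret A: assoc_alg free_alg by (rule free_alg_is_alg)
  interpret h: assoc_alg_hom free_alg B h by unfold_locales (rule h)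
  interpret h': assoc_alg_hom free_alg B h' by unfold_locales (rule h')
  let ?M = "\<lparr>carrier = UNIV, mult = (@), one = []\<rparr> :: 'g list monoid"
  have "h (Poly_Mapping.single w (1::'a)) = h' (Poly_Mapping.single w 1)" for w :: "'g list"
  proof (induction w)
    case Nil
    have "Poly_Mapping.single [] 1 = \<one>\<^bsub>free_alg\<^esub>" by (simp add: free_alg_def monoid_alg_def)
    then show ?case using h.hom_one h'.hom_one by metis
  next
    case (Cons g w)
    have "Poly_Mapping.single (g # w) (1::'a) = free_gen g \<otimes>\<^bsub>free_alg\<^esub> Poly_Mapping.single w 1"
      by (simp add: free_alg_def free_gen_def monoid_alg_mult_single)
    then show ?case using eq Cons.IH by simp
  qed
  moreover have "monoid ?M" by (rule monoidI) auto
  ultimately show ?thesis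
    using alg_hom_monoid_alg_eqI[of ?M B h h' p] B h h' carrier_free_alg[of p] unfolding free_alg_def by simp
qed

lemma rel_ideal_is_ideal: "ideal (rel_ideal R) free_alg"
proof -
  interpret assoc_alg free_alg by (rule free_alg_is_alg)
  show ?thesis unfolding rel_ideal_def by (rule genideal_ideal) auto
qed

lemma presented_alg_is_alg: "assoc_alg (presented_alg R)"
  unfolding presented_alg_def by (intro quot_alg_is_alg free_alg_is_alg rel_ideal_is_ideal)

abbreviation presented_proj where
  "presented_proj R x \<equiv> rel_ideal R +>\<^bsub>free_alg\<^esub> x"

lemma presented_proj_alg_hom: "presented_proj R \<in> alg_hom free_alg (presented_alg R)"
  unfolding presented_alg_def by (intro coset_alg_hom free_alg_is_alg rel_ideal_is_ideal)

lemma presented_gen_closed: "presented_gen R g \<in> carrier (presented_alg R)"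
  by (auto simp: presented_gen_def presented_alg_def carrier_quot_alg)

lemma presented_proj_rel:
  fixes R :: "(('g list \<Rightarrow>\<^sub>0 'a::field) \<times> ('g list \<Rightarrow>\<^sub>0 'a)) set"
  assumes "(x, y) \<in> R"
  shows "presented_proj R x = presented_proj R y"
proof -
  interpret assoc_alg "free_alg :: ('a, 'g list \<Rightarrow>\<^sub>0 'a) module" by (rule free_alg_is_alg)
  interpret I: ideal "rel_ideal R" free_alg by (rule rel_ideal_is_ideal)
  have "x \<ominus>\<^bsub>free_alg\<^esub> y \<in> rel_ideal R"
    unfolding rel_ideal_def
    by (rule subsetD[OF genideal_self]) (use assms in auto)
  then show ?thesis
    using quotient_eq_iff_same_a_r_cos[OF rel_ideal_is_ideal, of x y R] by simp
qed

lemma alg_hom_presented_alg_eqI: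
  assumes B: "assoc_alg B" and h: "h \<in> alg_hom (presented_alg R) B" and h': "h' \<in> alg_hom (presented_alg R) B"
    and eq: "\<And>g. h (presented_gen R g) = h' (presented_gen R g)"
    and x: "x \<in> carrier (presented_alg R)"
  shows "h x = h' x"
proof -
  obtain p where p: "x = presented_proj R p"
    using x by (auto simp: presented_alg_def carrier_quot_alg)
  have "(h \<circ> presented_proj R) p = (h' \<circ> presented_proj R) p"
    by (rule alg_hom_free_alg_eqI[OF B])
      (use eq in \<open>simp_all add: alg_hom_compose[OF presented_proj_alg_hom] h h'
        del: comp_apply, simp add: presented_gen_def\<close>)
  then show ?thesis by (simp add: p)
qed

section \<open>Tensor products and polynomials\<close>

text \<open>
  The two factors map to \<open>T\<close> by \<open>a \<mapsto> a \<otimes> 1\<close> and \<open>b \<mapsto> 1 \<otimes> b\<close>, with commuting images that together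
  generate \<open>T\<close>. In particular a homomorphism on \<open>T\<close> is determined by its restrictions to them
  (\<open>alg_hom_tensor_eqI\<close>).
\<close>

locale alg_tensor = A: assoc_alg A + B: assoc_alg B
  for A :: "('a::field, 'b) module" and B :: "('a, 'c) module"
begin

abbreviation T where "T \<equiv> tensor_alg A B"
abbreviation t where "t \<equiv> tensor A B"
abbreviation F where "F \<equiv> monoid_alg (A \<times>\<times> B) :: ('a, 'b \<times> 'c \<Rightarrow>\<^sub>0 'a) module"

lemma monoid_prod: "monoid (A \<times>\<times> B)"
  by (intro DirProd_monoid A.monoid_axioms B.monoid_axioms)

lemma F_is_alg: "assoc_alg F"
  by (intro monoid_alg_is_alg monoid_prod)

sublocale F: assoc_alg F by (rule F_is_alg)

lemma tensor_rels_subset: "tensor_rels A B \<subseteq> carrier F"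
proof
  fix r assume "r \<in> tensor_rels A B"
  then show "r \<in> carrier F"
    by cases (auto simp: monoid_alg_simps in_keys_iff lookup_minus lookup_add lookup_single when_def
        split: if_splits)
qed

lemma tensor_ideal_is_ideal: "ideal (tensor_ideal A B) F"
  unfolding tensor_ideal_def by (rule F.genideal_ideal[OF tensor_rels_subset])

sublocale T: assoc_alg T
  unfolding tensor_alg_def by (rule quot_alg_is_alg[OF F_is_alg tensor_ideal_is_ideal])

abbreviation proj where "proj x \<equiv> tensor_ideal A B +>\<^bsub>F\<^esub> x"

sublocale proj: assoc_alg_hom F T proj
  by unfold_locales
    (simp add: tensor_alg_def coset_alg_hom[OF F_is_alg tensor_ideal_is_ideal])

lemma single_closed [simp]: "\<lbrakk>a \<in> carrier A; b \<in> carrier B\<rbrakk> \<Longrightarrow> Poly_Mapping.single (a, b) c \<in> carrier F"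
  by (simp add: monoid_alg_simps)

lemma tensor_closed [simp]: "\<lbrakk>a \<in> carrier A; b \<in> carrier B\<rbrakk> \<Longrightarrow> t a b \<in> carrier T"
  unfolding tensor_def by (intro proj.hom_closed) simp

lemma proj_single:
  assumes "a \<in> carrier A" "b \<in> carrier B"
  shows "proj (Poly_Mapping.single (a, b) c) = c \<odot>\<^bsub>T\<^esub> t a b"
proof -
  have "Poly_Mapping.single (a, b) c = c \<odot>\<^bsub>F\<^esub> Poly_Mapping.single (a, b) 1"
    by (simp add: monoid_alg_simps)
  then show ?thesis using assms by (simp add: tensor_def)
qed

lemma proj_rel:
  assumes "x - y \<in> tensor_rels A B" "y \<in> carrier F"
  shows "proj x = proj y"
proof -
  have I: "x - y \<in> tensor_ideal A B"
    unfolding tensor_ideal_def by (rule subsetD[OF F.genideal_self[OF tensor_rels_subset] assms(1)])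
  have "tensor_ideal A B = \<zero>\<^bsub>T\<^esub>"
    unfolding tensor_alg_def quot_alg_def FactRing_def by simp
  with F.a_rcos_zero[OF tensor_ideal_is_ideal I] have 0: "proj (x - y) = \<zero>\<^bsub>T\<^esub>"
    by (rule trans)
  have closed: "x - y \<in> carrier F" by (rule subsetD[OF tensor_rels_subset assms(1)])
  have "(x - y) \<oplus>\<^bsub>F\<^esub> y = x" by (simp add: monoid_alg_simps(4))
  with proj.hom_add[OF closed assms(2)] have "proj x = proj (x - y) \<oplus>\<^bsub>T\<^esub> proj y"
    by (simp only:)
  also have "\<dots> = proj y"
    unfolding 0 by (rule T.l_zero) (rule proj.hom_closed[OF assms(2)])
  finally show ?thesis .
qed

lemma proj_add: "\<lbrakk>x \<in> carrier F; y \<in> carrier F\<rbrakk> \<Longrightarrow> proj (x + y) = proj x \<oplus>\<^bsub>T\<^esub> proj y"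
  using proj.hom_add[of x y] unfolding monoid_alg_simps(4) .

lemma F_add: "\<lbrakk>x \<in> carrier F; y \<in> carrier F\<rbrakk> \<Longrightarrow> x + y \<in> carrier F"
  using F.a_closed[of x y] unfolding monoid_alg_simps(4) .

lemma tensor_add_left:
  "\<lbrakk>a \<in> carrier A; a' \<in> carrier A; b \<in> carrier B\<rbrakk> \<Longrightarrow> t (a \<oplus>\<^bsub>A\<^esub> a') b = t a b \<oplus>\<^bsub>T\<^esub> t a' b"
  using proj_rel[OF tensor_rels.add_left] unfolding tensor_def by (simp add: proj_add F_add)

lemma tensor_add_right:
  "\<lbrakk>a \<in> carrier A; b \<in> carrier B; b' \<in> carrier B\<rbrakk> \<Longrightarrow> t a (b \<oplus>\<^bsub>B\<^esub> b') = t a b \<oplus>\<^bsub>T\<^esub> t a b'"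
  using proj_rel[OF tensor_rels.add_right] unfolding tensor_def by (simp add: proj_add F_add)

lemma tensor_smult_left: "\<lbrakk>a \<in> carrier A; b \<in> carrier B\<rbrakk> \<Longrightarrow> t (c \<odot>\<^bsub>A\<^esub> a) b = c \<odot>\<^bsub>T\<^esub> t a b"
  using proj_rel[OF tensor_rels.smult_left, of a b c] proj_single[of a b c] by (simp add: tensor_def)

lemma tensor_smult_right: "\<lbrakk>a \<in> carrier A; b \<in> carrier B\<rbrakk> \<Longrightarrow> t a (c \<odot>\<^bsub>B\<^esub> b) = c \<odot>\<^bsub>T\<^esub> t a b"
  using proj_rel[OF tensor_rels.smult_right, of a b c] proj_single[of a b c] by (simp add: tensor_def)

lemma tensor_mult:
  "\<lbrakk>a \<in> carrier A; a' \<in> carrier A; b \<in> carrier B; b' \<in> carrier B\<rbrakk>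
    \<Longrightarrow> t a b \<otimes>\<^bsub>T\<^esub> t a' b' = t (a \<otimes>\<^bsub>A\<^esub> a') (b \<otimes>\<^bsub>B\<^esub> b')"
  unfolding tensor_def by (simp add: monoid_alg_mult_single flip: proj.hom_mult)

lemma tensor_one: "t \<one>\<^bsub>A\<^esub> \<one>\<^bsub>B\<^esub> = \<one>\<^bsub>T\<^esub>"
  using proj.hom_one unfolding tensor_def by (simp add: monoid_alg_simps)

lemma left_alg_hom: "(\<lambda>a. t a \<one>\<^bsub>B\<^esub>) \<in> alg_hom A T"
  by (auto simp: alg_hom_def intro!: ring_hom_memI
      simp: tensor_add_left tensor_smult_left tensor_mult tensor_one)

lemma right_alg_hom: "(\<lambda>b. t \<one>\<^bsub>A\<^esub> b) \<in> alg_hom B T"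
  by (auto simp: alg_hom_def intro!: ring_hom_memI
      simp: tensor_add_right tensor_smult_right tensor_mult tensor_one)

lemma left_mult_right:
  "\<lbrakk>a \<in> carrier A; b \<in> carrier B\<rbrakk> \<Longrightarrow> t a \<one>\<^bsub>B\<^esub> \<otimes>\<^bsub>T\<^esub> t \<one>\<^bsub>A\<^esub> b = t a b"
  by (simp add: tensor_mult)

lemma right_mult_left:
  "\<lbrakk>a \<in> carrier A; b \<in> carrier B\<rbrakk> \<Longrightarrow> t \<one>\<^bsub>A\<^esub> b \<otimes>\<^bsub>T\<^esub> t a \<one>\<^bsub>B\<^esub> = t a b"
  by (simp add: tensor_mult)

lemma alg_hom_tensor_eqI:
  assumes C: "assoc_alg C" and h: "h \<in> alg_hom T C" and h': "h' \<in> alg_hom T C"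
    and left: "\<And>a. a \<in> carrier A \<Longrightarrow> h (t a \<one>\<^bsub>B\<^esub>) = h' (t a \<one>\<^bsub>B\<^esub>)"
    and right: "\<And>b. b \<in> carrier B \<Longrightarrow> h (t \<one>\<^bsub>A\<^esub> b) = h' (t \<one>\<^bsub>A\<^esub> b)"
    and x: "x \<in> carrier T"
  shows "h x = h' x"
proof -
  interpret C: assoc_alg C by fact
  interpret h: assoc_alg_hom T C h by unfold_locales (rule h)
  interpret h': assoc_alg_hom T C h' by unfold_locales (rule h')
  have gen: "h (t a b) = h' (t a b)" if a: "a \<in> carrier A" and b: "b \<in> carrier B" for a b
  proof -
    have "h (t a b) = h (t a \<one>\<^bsub>B\<^esub>) \<otimes>\<^bsub>C\<^esub> h (t \<one>\<^bsub>A\<^esub> b)"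
      unfolding left_mult_right[OF a b, symmetric] using a b by (intro h.hom_mult) simp_all
    also have "\<dots> = h' (t a \<one>\<^bsub>B\<^esub>) \<otimes>\<^bsub>C\<^esub> h' (t \<one>\<^bsub>A\<^esub> b)"
      by (simp only: left[OF a] right[OF b])
    also have "\<dots> = h' (t a b)"
      unfolding left_mult_right[OF a b, symmetric] using a b by (intro h'.hom_mult[symmetric]) simp_all
    finally show ?thesis .
  qed
  obtain p where p: "p \<in> carrier F" "x = proj p"
    using x by (auto simp: tensor_alg_def carrier_quot_alg)
  have "(h \<circ> proj) p = (h' \<circ> proj) p"
  proof (rule alg_hom_monoid_alg_eqI[OF monoid_prod C _ _ _ p(1)])
    show "h \<circ> proj \<in> alg_hom F C" "h' \<circ> proj \<in> alg_hom F C"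
      by (rule alg_hom_compose[OF proj.alg_hom], fact)+
    show "(h \<circ> proj) (Poly_Mapping.single x 1) = (h' \<circ> proj) (Poly_Mapping.single x 1)"
      if "x \<in> carrier (A \<times>\<times> B)" for x
      using that gen by (cases x) (simp add: tensor_def)
  qed
  then show ?thesis by (simp add: p)
qed

end

lemma poly_alg_simps:
  "carrier poly_alg = UNIV" "mult poly_alg = (*)" "one poly_alg = 1"
  "zero poly_alg = 0" "add poly_alg = (+)" "smult poly_alg = (\<lambda>c p. Poly_Mapping.single 0 c * p)"
  by (simp_all add: poly_alg_def mult_map_scale_conv_mult fun_eq_iff)

lemma poly_alg_is_alg: "assoc_alg (poly_alg :: ('a::field, _) module)"
proof -
  let ?P = "poly_alg :: ('a, _) module"
  have "ring ?P"
  proof (intro ringI abelian_groupI monoidI)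
    fix x assume "x \<in> carrier ?P"
    show "\<exists>y\<in>carrier ?P. y \<oplus>\<^bsub>?P\<^esub> x = \<zero>\<^bsub>?P\<^esub>"
      by (intro bexI[of _ "- x"]) (simp_all add: poly_alg_simps)
  qed (simp_all add: poly_alg_simps algebra_simps)
  then interpret ring ?P .
  show ?thesis
    by unfold_locales (simp_all add: poly_alg_simps algebra_simps single_add mult_single
        flip: mult.assoc)
qed

lemma alg_hom_poly_alg_eqI:
  fixes B :: "('a::field, 'c) module"
  assumes B: "assoc_alg B" and h: "h \<in> alg_hom poly_alg B" and h': "h' \<in> alg_hom poly_alg B"
    and eq: "\<And>n. n \<ge> 1 \<Longrightarrow> h (zvar n) = h' (zvar n)"
  shows "h p = h' p"
proof -
  let ?P = "poly_alg :: ('a, _) module"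
  interpret B: assoc_alg B by fact
  interpret P: assoc_alg ?P by (rule poly_alg_is_alg)
  interpret h: assoc_alg_hom ?P B h by unfold_locales (rule h)
  interpret h': assoc_alg_hom ?P B h' by unfold_locales (rule h')
  have mult: "h (x * y) = h' (x * y)" if "h x = h' x" "h y = h' y" for x y
    using that h.hom_mult[of x y] h'.hom_mult[of x y] by (simp add: poly_alg_simps)
  have add: "h (x + y) = h' (x + y)" if "h x = h' x" "h y = h' y" for x y
    using that h.hom_add[of x y] h'.hom_add[of x y] by (simp add: poly_alg_simps)
  have one: "h 1 = h' 1" using h.hom_one h'.hom_one by (simp add: poly_alg_simps)
  have power: "h (Poly_Mapping.single (Poly_Mapping.single k v) 1)
      = h' (Poly_Mapping.single (Poly_Mapping.single k v) 1)" for k v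
  proof (induction v)
    case (Suc v)
    have "Poly_Mapping.single (Poly_Mapping.single k (Suc v)) 1 = zvar (Suc k) *
        Poly_Mapping.single (Poly_Mapping.single k v) (1::'a)"
      by (simp add: zvar_def mult_single flip: single_add)
    then show ?case using mult[OF eq[of "Suc k"] Suc.IH] by simp
  qed (simp add: one)
  have monom: "h (Poly_Mapping.single m 1) = h' (Poly_Mapping.single m 1)" for m
    using subset_UNIV
  proof (induction m rule: poly_mapping_additive_induct)
    case (add p r)
    then show ?case using mult by (metis mult_single mult_1)
  qed (simp_all add: one power)
  show ?thesis using subset_UNIV
  proof (induction p rule: poly_mapping_additive_induct)
    case zero
    show ?case using h.hom_zero h'.hom_zero by (simp add: poly_alg_simps)
  next
    case (single m c)
    have "Poly_Mapping.single m c = c \<odot>\<^bsub>?P\<^esub> Poly_Mapping.single m 1"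
      by (simp add: poly_alg_simps mult_single)
    then show ?case
      using monom h.hom_smult[of "Poly_Mapping.single m 1" c] h'.hom_smult[of "Poly_Mapping.single m 1" c]
      by (simp add: poly_alg_simps)
  qed (rule add)
qed

section \<open>The alternating elements and the alternating generators\<close>

lemma U_alg_is_alg: "assoc_alg (U_alg q)"
  unfolding U_alg_def by (rule presented_alg_is_alg)

lemma calU_alg_is_alg: "assoc_alg (calU_alg q)"
  unfolding calU_alg_def by (rule presented_alg_is_alg)

text \<open>
  All four families are treated in one induction because their recursions are interleaved.
\<close>

lemma alt_closed:
  "alt_W q (- int n) \<in> carrier (U_alg q) \<and> alt_W q (int n + 1) \<in> carrier (U_alg q)
    \<and> alt_G q n \<in> carrier (U_alg q) \<and> alt_Gt q n \<in> carrier (U_alg q)"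
proof (induction n rule: less_induct)
  case (less n)
  interpret U: assoc_alg "U_alg q" by (rule U_alg_is_alg)
  have W01: "alt_W q 0 \<in> carrier (U_alg q)" "alt_W q 1 \<in> carrier (U_alg q)"
    by (simp_all add: alt_W_0 alt_W_1 U_alg_def presented_gen_closed)
  show ?case
  proof (cases n)
    case (Suc m)
    have pos: "alt_W q (int n - int k) \<in> carrier (U_alg q)" if "k < n" for k
      using less.IH[of "n - k - 1"] that by (simp add: of_nat_diff algebra_simps)
    have G: "alt_G q n \<in> carrier (U_alg q)"
      using Suc less.IH pos pos[of 0] W01
      by (subst alt_G_pos) (auto intro!: U.finsum_closed)
    moreover have "alt_Gt q n \<in> carrier (U_alg q)"
      using Suc G pos[of 0] W01 by (subst alt_Gt_pos) auto
    ultimately show ?thesis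
      using alt_W_neg[of n q] alt_W_pos[of n q] Suc W01 by auto
  qed (simp add: W01 alt_G_0 alt_Gt_0)
qed

text \<open>
  Substituting \<open>G'\<^sub>n = G\<^sub>n + [W\<^sub>0, W\<^sub>n] / (1 - q\<^sup>-\<^sup>2)\<close> into \<open>q\<^sup>n G'\<^sub>n + q\<^sup>-\<^sup>n G\<^sub>n\<close> turns the recursive formula
  for \<open>G\<^sub>n\<close> into the statement that the analogue of \<open>Z\<^sup>\<or>\<^sub>n\<close> in \<open>U\<^sup>+\<^sub>q\<close> vanishes for \<open>n \<ge> 1\<close>.
\<close>

lemma alternating_system_U:
  assumes q: "q \<noteq> 0" "\<And>n::nat. n \<ge> 1 \<Longrightarrow> q ^ n \<noteq> 1"
  shows "alternating_system (U_alg q) q (\<lambda>n. alt_W q (- int n)) (\<lambda>n. alt_W q (int n + 1))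
    (alt_G q) (alt_Gt q) (\<lambda>n. if n = 0 then \<one>\<^bsub>U_alg q\<^esub> else \<zero>\<^bsub>U_alg q\<^esub>)"
proof -
  let ?U = "U_alg q" and ?Wm = "\<lambda>n. alt_W q (- int n)" and ?Wp = "\<lambda>n. alt_W q (int n + 1)"
  interpret U: assoc_alg ?U by (rule U_alg_is_alg)
  have closed [simp]: "alt_W q (- int n) \<in> carrier ?U" "alt_W q (int n + 1) \<in> carrier ?U"
    "alt_G q n \<in> carrier ?U" "alt_Gt q n \<in> carrier ?U" for n
    using alt_closed[of q n] by auto
  have W0 [simp]: "alt_W q 0 \<in> carrier ?U" and W1 [simp]: "alt_W q 1 \<in> carrier ?U"
    using closed(1,2)[of 0] by auto
  have q2: "q - inverse q \<noteq> 0" "1 - q powi (- 2) \<noteq> 0"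
    using q(1) q(2)[of 2] by (auto simp: field_simps power2_eq_square power_int_minus)
  let ?X = "\<lambda>n. comm ?U (alt_W q 0) (?Wp n)" and ?c = "1 / (1 - q powi (- 2))"
  have Gt: "alt_Gt q (Suc n) = alt_G q (Suc n) \<oplus>\<^bsub>?U\<^esub> ?c \<odot>\<^bsub>?U\<^esub> ?X n" for n
    using alt_Gt_pos[of "Suc n" q] by (simp add: comm_def add.commute)
  show ?thesis
  proof
    fix n
    show "comm ?U (?Wm 0) (?Wp n)
        = (1 - q powi (- 2)) \<odot>\<^bsub>?U\<^esub> (alt_Gt q (Suc n) \<ominus>\<^bsub>?U\<^esub> alt_G q (Suc n))"
    proof -
      have "alt_Gt q (Suc n) \<ominus>\<^bsub>?U\<^esub> alt_G q (Suc n) = ?c \<odot>\<^bsub>?U\<^esub> ?X n"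
        unfolding Gt by (subst U.a_comm) (simp_all add: U.add_diff_cancel)
      then show ?thesis using q2 by (simp add: U.smult_smult)
    qed
    show "qcomm ?U q (?Wm 0) (alt_G q n) = (q - inverse q) \<odot>\<^bsub>?U\<^esub> ?Wm n"
    proof (cases "n = 0")
      case True
      then show ?thesis by (simp add: qcomm_def alt_G_0 U.smult_diff_left)
    next
      case False
      then have "?Wm n = (1 / (q - inverse q)) \<odot>\<^bsub>?U\<^esub> qcomm ?U q (alt_W q 0) (alt_G q n)"
        by (simp add: alt_W_neg qcomm_def)
      then show ?thesis using q2 by (simp add: U.smult_smult)
    qed
    show "qcomm ?U q (alt_G q n) (?Wp 0) = (q - inverse q) \<odot>\<^bsub>?U\<^esub> ?Wp n"
    proof (cases "n = 0")
      case True
      then show ?thesis by (simp add: qcomm_def alt_G_0 U.smult_diff_left)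
    next
      case False
      then have "?Wp n = (1 / (q - inverse q)) \<odot>\<^bsub>?U\<^esub> qcomm ?U q (alt_G q n) (alt_W q 1)"
        by (simp add: alt_W_pos qcomm_def)
      then show ?thesis using q2 by (simp add: U.smult_smult)
    qed
    define N where "N = Suc n"
    define s where "s = q powi int N + q powi (- int N)"
    define I where "I = twconv_inner ?U q (alt_G q) (alt_Gt q) N"
    define V where "V = q \<odot>\<^bsub>?U\<^esub> twconv ?U q ?Wm ?Wp n"
    define X where "X = ?X n"
    have [simp]: "I \<in> carrier ?U" "V \<in> carrier ?U" "X \<in> carrier ?U"
      by (simp_all add: I_def V_def X_def)
    have s: "s \<noteq> 0" unfolding s_def by (rule q_power_sum_nonzero) (use q N_def in auto)
    (* This identity matches the commutator term of G with q^N times the one of Gt. *)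
    have d: "s * (1 / ((1 + q powi (- 2 * int N)) * (1 - q powi (- 2)))) = q powi int N * ?c"
    proof -
      have "s = q powi int N * (1 + q powi (- 2 * int N))"
        unfolding s_def using power_int_add[of q "int N" "- 2 * int N"] q(1) by (simp add: distrib_left)
      then show ?thesis using s by auto
    qed
    have pos: "alt_W q (1 + int n - int k) \<in> carrier ?U" if "k \<le> n" for k
      using closed(2)[of "n - k"] that by (simp add: of_nat_diff algebra_simps)
    have s_inverse: "s * (1 / s) = 1" using s by simp
    have V: "V = q \<odot>\<^bsub>?U\<^esub> (\<Oplus>\<^bsub>?U\<^esub>k\<in>{0..N-1}. (q powi (int N - 1 - 2 * int k)) \<odot>\<^bsub>?U\<^esub>
         (alt_W q (- int k) \<otimes>\<^bsub>?U\<^esub> alt_W q (int N - int k)))"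
      unfolding V_def twconv_def N_def
      by (intro arg_cong[where f = "\<lambda>x. q \<odot>\<^bsub>?U\<^esub> x"] U.finsum_cong')
        (auto simp: of_nat_diff pos algebra_simps)
    have "alt_G q N = (1 / s) \<odot>\<^bsub>?U\<^esub> (V \<ominus>\<^bsub>?U\<^esub> I)
        \<oplus>\<^bsub>?U\<^esub> (1 / ((1 + q powi (- 2 * int N)) * (1 - q powi (- 2)))) \<odot>\<^bsub>?U\<^esub> (\<ominus>\<^bsub>?U\<^esub> X)"
    proof -
      have "comm ?U (?Wp n) (alt_W q 0) = \<ominus>\<^bsub>?U\<^esub> X" unfolding X_def by (rule U.comm_swap) simp_all
      moreover have "{1..N-1} = {1..<N}" by (auto simp: N_def)
      ultimately show ?thesis
        using alt_G_pos[of N q]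
        by (simp add: V s_def I_def twconv_inner_def comm_def N_def add.commute)
    qed
    then have "s \<odot>\<^bsub>?U\<^esub> alt_G q N = (V \<ominus>\<^bsub>?U\<^esub> I) \<ominus>\<^bsub>?U\<^esub> (q powi int N * ?c) \<odot>\<^bsub>?U\<^esub> X"
      using s_inverse d
      by (simp add: U.smult_r_distr U.smult_smult U.smult_minus U.minus_eq del: times_divide_eq_right)
    moreover have "(q powi int N) \<odot>\<^bsub>?U\<^esub> alt_Gt q N \<oplus>\<^bsub>?U\<^esub> (q powi (- int N)) \<odot>\<^bsub>?U\<^esub> alt_G q N
        = s \<odot>\<^bsub>?U\<^esub> alt_G q N \<oplus>\<^bsub>?U\<^esub> (q powi int N * ?c) \<odot>\<^bsub>?U\<^esub> X"
      unfolding s_def N_def Gt X_def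
      by (simp add: U.smult_r_distr U.smult_l_distr U.smult_smult U.a_ac del: times_divide_eq_right)
    ultimately have "(q powi int N) \<odot>\<^bsub>?U\<^esub> alt_Gt q N \<oplus>\<^bsub>?U\<^esub> (q powi (- int N)) \<odot>\<^bsub>?U\<^esub> alt_G q N
        = V \<ominus>\<^bsub>?U\<^esub> I"
      by (simp add: U.diff_add_cancel)
    then have "twconv ?U q (alt_G q) (alt_Gt q) N = V"
      by (subst U.twconv_ends) (simp_all add: alt_G_0 alt_Gt_0 N_def[symmetric] U.diff_add_cancel
          flip: I_def, simp add: N_def)
    then show "twconv ?U q (alt_G q) (alt_Gt q) (Suc n) \<ominus>\<^bsub>?U\<^esub> q \<odot>\<^bsub>?U\<^esub> twconv ?U q ?Wm ?Wp n
        = (if Suc n = 0 then \<one>\<^bsub>?U\<^esub> else \<zero>\<^bsub>?U\<^esub>)"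
      by (simp add: N_def V_def U.minus_eq U.r_neg)
  qed (use q in \<open>simp_all add: alt_G_0 alt_Gt_0\<close>)
qed

lemma cal_closed:
  "calW q i \<in> carrier (calU_alg q)" "calG q n \<in> carrier (calU_alg q)" "calGt q n \<in> carrier (calU_alg q)"
proof -
  interpret assoc_alg "calU_alg q" by (rule calU_alg_is_alg)
  show "calW q i \<in> carrier (calU_alg q)" "calG q n \<in> carrier (calU_alg q)"
    "calGt q n \<in> carrier (calU_alg q)"
    using presented_gen_closed[of "calU_rels q"] one_closed
    by (auto simp: calW_def calG_def calGt_def simp flip: calU_alg_def)
qed

lemma Z_closed: "Z_elt q n \<in> carrier (calU_alg q)"
proof (induction n rule: less_induct)
  case (less n)
  interpret assoc_alg "calU_alg q" by (rule calU_alg_is_alg)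
  have "Z_vee q n \<in> carrier (calU_alg q)"
    unfolding Z_vee_def by (auto simp: cal_closed intro!: finsum_closed minus_closed smult_closed)
  then show ?case
    using less.IH by (subst Z_elt.simps) (auto intro!: finsum_closed minus_closed smult_closed)
qed

lemma Z_elt_0: "Z_elt q 0 = \<one>\<^bsub>calU_alg q\<^esub>"
  by (simp add: Z_elt.simps)

text \<open>
  The recursion for \<open>Z\<^sub>n\<close> solves \<open>Z(t/q) Z(qt) = Z\<^sup>\<or>(t)\<close> degree by degree.
\<close>

lemma twconv_Z_elt:
  assumes q: "q \<noteq> 0" "\<And>n::nat. n \<ge> 1 \<Longrightarrow> q ^ n \<noteq> 1"
  shows "twconv (calU_alg q) q (Z_elt q) (Z_elt q) n = Z_vee q n"
proof (cases "n = 0")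
  case True
  interpret assoc_alg "calU_alg q" by (rule calU_alg_is_alg)
  show ?thesis by (simp add: True Z_closed Z_elt_0 Z_vee_def)
next
  case False
  interpret assoc_alg "calU_alg q" by (rule calU_alg_is_alg)
  let ?I = "twconv_inner (calU_alg q) q (Z_elt q) (Z_elt q) n"
  define s where "s = q powi int n + q powi (- int n)"
  have s: "s \<noteq> 0" unfolding s_def by (rule q_power_sum_nonzero) (use q False in auto)
  have vee [simp]: "Z_vee q n \<in> carrier (calU_alg q)"
    unfolding Z_vee_def by (auto simp: cal_closed intro!: finsum_closed minus_closed smult_closed)
  have [simp]: "?I \<in> carrier (calU_alg q)" by (simp add: Z_closed)
  have "Z_elt q n = (1 / s) \<odot>\<^bsub>calU_alg q\<^esub> (Z_vee q n \<ominus>\<^bsub>calU_alg q\<^esub> ?I)"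
    using False by (subst Z_elt.simps) (simp add: s_def twconv_inner_def)
  then have "s \<odot>\<^bsub>calU_alg q\<^esub> Z_elt q n = Z_vee q n \<ominus>\<^bsub>calU_alg q\<^esub> ?I"
    using s by (simp add: smult_smult)
  then show ?thesis
    using False by (subst twconv_ends)
      (simp_all add: Z_closed Z_elt_0 diff_add_cancel s_def flip: smult_l_distr)
qed

lemma alternating_system_calU:
  assumes q: "q \<noteq> 0" "\<And>n::nat. n \<ge> 1 \<Longrightarrow> q ^ n \<noteq> 1"
  shows "alternating_system (calU_alg q) q (\<lambda>n. calW q (- int n)) (\<lambda>n. calW q (int n + 1))
    (calG q) (calGt q) (twconv (calU_alg q) q (Z_elt q) (Z_elt q))"
proof -
  let ?C = "calU_alg q" and ?Wm = "\<lambda>n. calW q (- int n)" and ?Wp = "\<lambda>n. calW q (int n + 1)"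
  interpret C: assoc_alg ?C by (rule calU_alg_is_alg)
  interpret F: assoc_alg "free_alg :: ('a, alt_gen list \<Rightarrow>\<^sub>0 'a) module" by (rule free_alg_is_alg)
  let ?p = "presented_proj (calU_rels q)"
  interpret p: assoc_alg_hom "free_alg :: ('a, alt_gen list \<Rightarrow>\<^sub>0 'a) module" ?C ?p
    by unfold_locales (simp add: calU_alg_def presented_proj_alg_hom)
  have pW: "?p (fW i) = calW q i" for i by (simp add: calW_def presented_gen_def)
  have pG: "?p (fG n) = calG q n" for n by (simp add: calG_def presented_gen_def)
  have pGt: "?p (fGt n) = calGt q n" for n by (simp add: calGt_def presented_gen_def)
  show ?thesis
  proof
    fix n
    show "comm ?C (?Wm 0) (?Wp n) = (1 - q powi (- 2)) \<odot>\<^bsub>?C\<^esub> (calGt q (Suc n) \<ominus>\<^bsub>?C\<^esub> calG q (Suc n))"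
      using presented_proj_rel[OF calU_rels.intros(1)[where q = q and k = n]]
      by (simp add: pW pG[of "Suc n", simplified] pGt[of "Suc n", simplified])
    show "qcomm ?C q (?Wm 0) (calG q n) = (q - inverse q) \<odot>\<^bsub>?C\<^esub> ?Wm n"
    proof (cases n)
      case 0
      then show ?thesis by (simp add: qcomm_def calG_def cal_closed C.smult_diff_left)
    next
      case (Suc k)
      then show ?thesis
        using presented_proj_rel[OF calU_rels.intros(3)[where q = q and k = k]]
        by (simp add: pW pG[of "Suc k", simplified] minus_diff_commute)
    qed
    show "qcomm ?C q (calG q n) (?Wp 0) = (q - inverse q) \<odot>\<^bsub>?C\<^esub> ?Wp n"
    proof (cases n)
      case 0
      then show ?thesis by (simp add: qcomm_def calG_def cal_closed C.smult_diff_left)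
    next
      case (Suc k)
      then show ?thesis
        using presented_proj_rel[OF calU_rels.intros(5)[where q = q and k = k]]
        by (simp add: pW pG[of "Suc k", simplified] add.commute)
    qed
    show "twconv ?C q (calG q) (calGt q) (Suc n) \<ominus>\<^bsub>?C\<^esub> q \<odot>\<^bsub>?C\<^esub> twconv ?C q ?Wm ?Wp n
        = twconv ?C q (Z_elt q) (Z_elt q) (Suc n)"
    proof -
      have "(\<Oplus>\<^bsub>?C\<^esub>k\<in>{..n}. (q powi (int n - 2 * int k)) \<odot>\<^bsub>?C\<^esub>
            (calW q (- int k) \<otimes>\<^bsub>?C\<^esub> calW q (int (Suc n) - int k))) = twconv ?C q ?Wm ?Wp n"
        unfolding twconv_def
        by (intro C.finsum_cong') (auto simp: cal_closed of_nat_diff algebra_simps)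
      then show ?thesis
        using twconv_Z_elt[of q "Suc n"] q by (simp add: Z_vee_def, simp add: twconv_def atLeast0AtMost)
    qed
  qed (use q in \<open>simp_all add: cal_closed Z_closed Z_elt_0, simp_all add: calG_def calGt_def\<close>)
qed

section \<open>The isomorphism\<close>

theorem theorem5p17:
  fixes q :: "'a::field"
    and varphi :: "(alt_gen list \<Rightarrow>\<^sub>0 'a) set \<Rightarrow>
      ((U_gen list \<Rightarrow>\<^sub>0 'a) set \<times> ((nat \<Rightarrow>\<^sub>0 nat) \<Rightarrow>\<^sub>0 'a) \<Rightarrow>\<^sub>0 'a) set"
    and phi :: "((U_gen list \<Rightarrow>\<^sub>0 'a) set \<times> ((nat \<Rightarrow>\<^sub>0 nat) \<Rightarrow>\<^sub>0 'a) \<Rightarrow>\<^sub>0 'a) set \<Rightarrow>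
      (alt_gen list \<Rightarrow>\<^sub>0 'a) set"
  assumes q_nonzero: "q \<noteq> 0"
    and q_not_root_of_unity: "\<And>n::nat. n \<ge> 1 \<Longrightarrow> q ^ n \<noteq> 1"
    and varphi_hom: "varphi \<in> alg_hom (calU_alg q) (U_poly_alg q)"
    and varphi_W_neg: "\<And>n::nat. varphi (calW q (- int n)) =
      (\<Oplus>\<^bsub>U_poly_alg q\<^esub>k\<in>{0..n}. U_tensor q (alt_W q (int k - int n)) (zvar k))"
    and varphi_W_pos: "\<And>n::nat. varphi (calW q (int n + 1)) =
      (\<Oplus>\<^bsub>U_poly_alg q\<^esub>k\<in>{0..n}. U_tensor q (alt_W q (int n + 1 - int k)) (zvar k))"
    and varphi_G: "\<And>n::nat. varphi (calG q n) =
      (\<Oplus>\<^bsub>U_poly_alg q\<^esub>k\<in>{0..n}. U_tensor q (alt_G q (n - k)) (zvar k))"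
    and varphi_Gt: "\<And>n::nat. varphi (calGt q n) =
      (\<Oplus>\<^bsub>U_poly_alg q\<^esub>k\<in>{0..n}. U_tensor q (alt_Gt q (n - k)) (zvar k))"
    and phi_hom: "phi \<in> alg_hom (U_poly_alg q) (calU_alg q)"
    and phi_W0: "phi (U_tensor q (alt_W q 0) \<one>\<^bsub>poly_alg\<^esub>) = calW q 0"
    and phi_W1: "phi (U_tensor q (alt_W q 1) \<one>\<^bsub>poly_alg\<^esub>) = calW q 1"
    and phi_z: "\<And>n::nat. n \<ge> 1 \<Longrightarrow> phi (U_tensor q \<one>\<^bsub>U_alg q\<^esub> (zvar n)) = Z_elt q n"
  shows "(\<forall>x\<in>carrier (calU_alg q). phi (varphi x) = x)
       \<and> (\<forall>y\<in>carrier (U_poly_alg q). varphi (phi y) = y)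
       \<and> bij_betw varphi (carrier (calU_alg q)) (carrier (U_poly_alg q))
       \<and> bij_betw phi (carrier (U_poly_alg q)) (carrier (calU_alg q))"
proof -
  let ?U = "U_alg q" and ?C = "calU_alg q" and ?T = "U_poly_alg q"
  let ?P = "poly_alg :: ('a, _) module"
  let ?L = "\<lambda>u. U_tensor q u \<one>\<^bsub>poly_alg\<^esub>" and ?R = "\<lambda>n. U_tensor q \<one>\<^bsub>?U\<^esub> (zvar n)"
  let ?Wm = "\<lambda>n. alt_W q (- int n)" and ?Wp = "\<lambda>n. alt_W q (int n + 1)"
  note q = q_nonzero q_not_root_of_unity
  interpret U: assoc_alg ?U by (rule U_alg_is_alg)
  interpret P: assoc_alg ?P by (rule poly_alg_is_alg)
  interpret C: assoc_alg ?C by (rule calU_alg_is_alg)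
  interpret UP: alg_tensor ?U ?P ..
  note T_def = U_poly_alg_def[of q, symmetric] and t_def = U_tensor_def[symmetric]
  interpret T: assoc_alg ?T using UP.T.assoc_alg_axioms unfolding T_def .
  have L: "?L \<in> alg_hom ?U ?T" using UP.left_alg_hom unfolding T_def t_def .
  have R: "U_tensor q \<one>\<^bsub>?U\<^esub> \<in> alg_hom ?P ?T" using UP.right_alg_hom unfolding T_def t_def .
  interpret L: assoc_alg_hom ?U ?T ?L by unfold_locales (rule L)
  interpret R: assoc_alg_hom ?P ?T "U_tensor q \<one>\<^bsub>?U\<^esub>" by unfold_locales (rule R)
  interpret varphi: assoc_alg_hom ?C ?T varphi by unfold_locales (rule varphi_hom)
  interpret phi: assoc_alg_hom ?T ?C phi by unfold_locales (rule phi_hom)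
  have P_carrier [simp]: "p \<in> carrier ?P" for p by (simp add: poly_alg_simps)
  have LR: "?L u \<otimes>\<^bsub>?T\<^esub> ?R n = U_tensor q u (zvar n)" "?R n \<otimes>\<^bsub>?T\<^esub> ?L u = U_tensor q u (zvar n)"
    if "u \<in> carrier ?U" for u n
    using UP.left_mult_right[OF that P_carrier] UP.right_mult_left[OF that P_carrier]
    unfolding T_def t_def by auto
  have alt [simp]: "alt_W q (- int n) \<in> carrier ?U" "alt_W q (int n + 1) \<in> carrier ?U"
    "alt_G q n \<in> carrier ?U" "alt_Gt q n \<in> carrier ?U" for n
    using alt_closed[of q n] by auto
  have R_closed: "?R n \<in> carrier ?T" for n by (rule R.hom_closed) simp
  have R_0: "?R 0 = \<one>\<^bsub>?T\<^esub>" using R.hom_one by (simp add: zvar_def poly_alg_simps)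

  have tensor_closed: "U_tensor q u (zvar k) \<in> carrier ?T" if "u \<in> carrier ?U" for u k
    unfolding LR(1)[OF that, symmetric] using that R_closed by (intro T.m_closed L.hom_closed) auto
  (* Convolution with the series of the 1 \<otimes> z is the shape of the values prescribed for varphi,
     up to reversing the order of summation. *)
  have conv_eq: "conv ?T (\<lambda>n. ?L (f n)) ?R n = (\<Oplus>\<^bsub>?T\<^esub>k\<in>{0..n}. U_tensor q (f (n - k)) (zvar k))"
    if f: "\<And>n. f n \<in> carrier ?U" for f n
  proof -
    have "conv ?T (\<lambda>n. ?L (f n)) ?R n = (\<Oplus>\<^bsub>?T\<^esub>k\<in>{..n}. U_tensor q (f k) (zvar (n - k)))"
      unfolding conv_def by (simp add: LR f)
    also have "\<dots> = (\<Oplus>\<^bsub>?T\<^esub>k\<in>{..n}. (\<lambda>i. U_tensor q (f (n - i)) (zvar i)) (n - k))"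
      by (intro T.finsum_cong') (auto simp: tensor_closed f)
    also have "\<dots> = (\<Oplus>\<^bsub>?T\<^esub>k\<in>{..n}. U_tensor q (f (n - k)) (zvar k))"
      by (rule T.finsum_flip) (rule tensor_closed[OF f])
    finally show ?thesis by (simp add: atLeast0AtMost)
  qed
  have varphi_cal:
    "varphi (calW q (- int n)) = conv ?T (\<lambda>n. ?L (?Wm n)) ?R n"
    "varphi (calW q (int n + 1)) = conv ?T (\<lambda>n. ?L (?Wp n)) ?R n"
    "varphi (calG q n) = conv ?T (\<lambda>n. ?L (alt_G q n)) ?R n"
    "varphi (calGt q n) = conv ?T (\<lambda>n. ?L (alt_Gt q n)) ?R n" for n
  proof -
    have index: "int k - int n = - int (n - k)" "int n + 1 - int k = int (n - k) + 1"
      if "k \<in> {0..n}" for k using that by (simp_all add: of_nat_diff)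
    show "varphi (calW q (- int n)) = conv ?T (\<lambda>n. ?L (?Wm n)) ?R n"
      unfolding varphi_W_neg conv_eq[of ?Wm, OF alt(1)]
      by (intro T.finsum_cong') (simp_all only: index, auto intro: tensor_closed alt)
    show "varphi (calW q (int n + 1)) = conv ?T (\<lambda>n. ?L (?Wp n)) ?R n"
      unfolding varphi_W_pos conv_eq[of ?Wp, OF alt(2)]
      by (intro T.finsum_cong') (simp_all only: index, auto intro: tensor_closed alt)
  qed (simp_all only: varphi_G varphi_Gt conv_eq alt)

  have "alternating_system ?T q (\<lambda>n. ?L (?Wm n)) (\<lambda>n. ?L (?Wp n)) (\<lambda>n. ?L (alt_G q n))
      (\<lambda>n. ?L (alt_Gt q n)) (\<lambda>n. ?L (if n = 0 then \<one>\<^bsub>?U\<^esub> else \<zero>\<^bsub>?U\<^esub>))"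
    by (rule L.hom_alternating_system[OF alternating_system_U]) (use q in auto)
  then have "alternating_system ?T q (conv ?T (\<lambda>n. ?L (?Wm n)) ?R) (conv ?T (\<lambda>n. ?L (?Wp n)) ?R)
      (conv ?T (\<lambda>n. ?L (alt_G q n)) ?R) (conv ?T (\<lambda>n. ?L (alt_Gt q n)) ?R) (twconv ?T q ?R ?R)"
    by (rule alternating_system.conv_system) (simp_all only: LR alt R_closed R_0 L.hom_zero nat.simps if_False)
  (* One quadruple, the image of the generators, carries two defects: the one computed from the
     prescribed values and the one transported from the source of varphi. *)
  then have sys_z: "alternating_system ?T q (\<lambda>n. varphi (calW q (- int n))) (\<lambda>n. varphi (calW q (int n + 1)))
      (\<lambda>n. varphi (calG q n)) (\<lambda>n. varphi (calGt q n)) (twconv ?T q ?R ?R)"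
    unfolding varphi_cal .
  have sys_C: "alternating_system ?C q (\<lambda>n. calW q (- int n)) (\<lambda>n. calW q (int n + 1))
      (calG q) (calGt q) (twconv ?C q (Z_elt q) (Z_elt q))"
    by (rule alternating_system_calU) (use q in auto)

  have varphi_Z: "varphi (Z_elt q n) = ?R n" for n
  proof -
    interpret S: alternating_system ?T q "\<lambda>n. varphi (calW q (- int n))" "\<lambda>n. varphi (calW q (int n + 1))"
      "\<lambda>n. varphi (calG q n)" "\<lambda>n. varphi (calGt q n)" "twconv ?T q ?R ?R"
      by (rule sys_z)
    interpret S': alternating_system ?T q "\<lambda>n. varphi (calW q (- int n))" "\<lambda>n. varphi (calW q (int n + 1))"
      "\<lambda>n. varphi (calG q n)" "\<lambda>n. varphi (calGt q n)" "\<lambda>n. varphi (twconv ?C q (Z_elt q) (Z_elt q) n)"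
      by (rule varphi.hom_alternating_system[OF sys_C])
    have "varphi (twconv ?C q (Z_elt q) (Z_elt q) n) = twconv ?T q ?R ?R n" for n
      using S.vee S'.vee S.zeroth(3) S'.zeroth(3) by (cases n) simp_all
    then have "twconv ?T q (\<lambda>n. varphi (Z_elt q n)) (\<lambda>n. varphi (Z_elt q n)) n = twconv ?T q ?R ?R n" for n
      using varphi.hom_twconv[of "Z_elt q" "Z_elt q" q n] by (simp add: Z_closed)
    then show ?thesis
      by (intro S.twconv_self_inj[of "\<lambda>n. varphi (Z_elt q n)" ?R])
        (simp_all add: Z_closed Z_elt_0 R_closed R_0)
  qed

  have phi_R: "phi (?R n) = Z_elt q n" for n
    by (cases "n = 0") (simp_all add: phi_z R_0 Z_elt_0)
  have phi_varphi_W_0: "phi (varphi (calW q 0)) = calW q 0"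
    "phi (varphi (calW q 1)) = calW q 1"
    using varphi_W_neg[of 0] varphi_W_pos[of 0] phi_W0 phi_W1 tensor_closed[of _ 0] alt(1,2)[of 0]
    by (simp_all add: zvar_def poly_alg_simps)
  have phi_varphi_cal:
    "phi (varphi (calW q (- int n))) = calW q (- int n) \<and> phi (varphi (calW q (int n + 1))) = calW q (int n + 1)
      \<and> phi (varphi (calG q n)) = calG q n \<and> phi (varphi (calGt q n)) = calGt q n" for n
  proof (rule alternating_system.unique[OF sys_C])
    have "(\<lambda>n. phi (twconv ?T q ?R ?R n)) = twconv ?C q (Z_elt q) (Z_elt q)"
      by (rule ext) (simp add: phi.hom_twconv R_closed phi_R)
    then show "alternating_system ?C q (\<lambda>n. phi (varphi (calW q (- int n))))
        (\<lambda>n. phi (varphi (calW q (int n + 1)))) (\<lambda>n. phi (varphi (calG q n)))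
        (\<lambda>n. phi (varphi (calGt q n))) (twconv ?C q (Z_elt q) (Z_elt q))"
      using phi.hom_alternating_system[OF sys_z] by simp
  qed (simp_all add: phi_varphi_W_0)

  have left_inverse: "phi (varphi x) = x" if x: "x \<in> carrier ?C" for x
  proof -
    have gen: "phi (varphi (presented_gen (calU_rels q) g)) = presented_gen (calU_rels q) g" for g
    proof (cases g)
      case (genW i)
      show ?thesis
      proof (cases "i \<le> 0")
        case True
        then show ?thesis using phi_varphi_cal[of "nat (- i)"] by (simp add: genW calW_def)
      next
        case False
        then show ?thesis using phi_varphi_cal[of "nat (i - 1)"] by (simp add: genW calW_def)
      qed
    next
      case (genG n)
      then show ?thesis using phi_varphi_cal[of "Suc n"] by (simp add: calG_def)
    next
      case (genGt n)
      then show ?thesis using phi_varphi_cal[of "Suc n"] by (simp add: calGt_def)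
    qed
    have "(phi \<circ> varphi) x = (\<lambda>x. x) x"
    proof (rule alg_hom_presented_alg_eqI)
      show "assoc_alg ?C" by (rule calU_alg_is_alg)
      show "phi \<circ> varphi \<in> alg_hom (presented_alg (calU_rels q)) ?C"
        using alg_hom_compose[OF varphi_hom phi_hom] by (simp only: calU_alg_def)
      show "(\<lambda>x. x) \<in> alg_hom (presented_alg (calU_rels q)) ?C"
        unfolding calU_alg_def by (rule alg_hom_id)
      show "x \<in> carrier (presented_alg (calU_rels q))" using x by (simp only: calU_alg_def)
    qed (simp add: gen)
    then show ?thesis by simp
  qed
  have right_inverse: "varphi (phi y) = y" if y: "y \<in> carrier ?T" for y
  proof -
    have hom: "varphi \<circ> phi \<in> alg_hom ?T ?T" by (rule alg_hom_compose[OF phi_hom varphi_hom])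
    have "(varphi \<circ> phi) (?L u) = ?L u" if "u \<in> carrier ?U" for u
    proof -
      have gen: "(varphi \<circ> phi) (?L (presented_gen (U_rels q) g)) = ?L (presented_gen (U_rels q) g)" for g
        using varphi_W_neg[of 0] varphi_W_pos[of 0] phi_W0 phi_W1 tensor_closed[of _ 0] alt(1,2)[of 0]
        by (cases g) (simp_all add: zvar_def poly_alg_simps flip: alt_W_0 alt_W_1)
      have "(varphi \<circ> phi \<circ> ?L) u = ?L u"
      proof (rule alg_hom_presented_alg_eqI[OF T.assoc_alg_axioms])
        show "varphi \<circ> phi \<circ> ?L \<in> alg_hom (presented_alg (U_rels q)) ?T"
          using alg_hom_compose[OF L hom] by (simp only: U_alg_def)
        show "?L \<in> alg_hom (presented_alg (U_rels q)) ?T" using L by (simp only: U_alg_def)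
        show "u \<in> carrier (presented_alg (U_rels q))" using that by (simp only: U_alg_def)
      qed (use gen in simp)
      then show ?thesis by simp
    qed
    moreover have "(varphi \<circ> phi) (U_tensor q \<one>\<^bsub>?U\<^esub> p) = U_tensor q \<one>\<^bsub>?U\<^esub> p" for p
    proof -
      have "(varphi \<circ> phi \<circ> U_tensor q \<one>\<^bsub>?U\<^esub>) p = U_tensor q \<one>\<^bsub>?U\<^esub> p"
        by (rule alg_hom_poly_alg_eqI[OF T.assoc_alg_axioms alg_hom_compose[OF R hom] R])
          (simp add: phi_z varphi_Z)
      then show ?thesis by simp
    qed
    ultimately have "(varphi \<circ> phi) y = (\<lambda>y. y) y"
      using UP.alg_hom_tensor_eqI[of ?T "varphi \<circ> phi" "\<lambda>y. y" y] T.assoc_alg_axioms hom alg_hom_id[of ?T] y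
      unfolding T_def t_def by blast
    then show ?thesis by simp
  qed
  have "bij_betw varphi (carrier ?C) (carrier ?T)" "bij_betw phi (carrier ?T) (carrier ?C)"
    using left_inverse right_inverse varphi.hom_closed phi.hom_closed
    by (auto intro!: bij_betw_byWitness[where f' = phi] bij_betw_byWitness[where f' = varphi])
  then show ?thesis using left_inverse right_inverse by blast
qed

end
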